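(* Let $n\ge1$ be an integer and $k\in\mathbf{N}_0$. Let $u_0,u_1\in L^2(\mathbf{R}^n)\cap L^{1,k}(\mathbf{R}^n)$, put $v:=u_0+u_1$, and let $\hat u$ be the Fourier-side solution associated with $(u_0,u_1)$ (see context). Then there exist constants $C>0$ and $\delta\ge1$, depending on $u_0$ and $u_1$, such that $$\frac12\left\|B_k^v\,e^{-|\xi|^2}\right\|_{L^2(|\xi|\le1/2)}\,t^{-\frac n4-\frac k2}\le\left\|\hat u(t)-A^v_{k-1}\,e^{-t|\xi|^2}\right\|_2\le C\,t^{-\frac n4-\frac k2}\qquad\text{for all } t\ge\delta .$$
   Context: Notation. $\mathbf{N}_0=\{0,1,2,\dots\}$; $\|\cdot\|_2$ is the $L^2(\mathbf{R}^n)$ norm in the variable $\xi$, and $\|\cdot\|_{L^2(|\xi|\le1/2)}$ the $L^2$ norm over $\{\xi\in\mathbf{R}^n:|\xi|\le1/2\}$. The Fourier transform is $\hat f(\xi)=\int_{\mathbf{R}^n}e^{-ix\cdot\xi}f(x)\,dx$ (extended to $L^2$ as usual). Weighted space: for $\gamma\ge0$, $L^{1,\gamma}(\mathbf{R}^n)=\{f\in L^1(\mathbf{R}^n): \|f\|_{1,\gamma}:=\int_{\mathbf{R}^n}(1+|x|)^\gamma|f(x)|\,dx<\infty\}$. Fourier-side solution: for $u_0,u_1\in L^2(\mathbf{R}^n)$, the solution of the Cauchy problem $u_{tt}-\Delta u+u_t-\Delta u_t=0$, $u(0,x)=u_0(x)$, $u_t(0,x)=u_1(x)$, is regarded as the function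 whose Fourier transform in $x$ is, for $t\ge0$ and (almost every) $\xi$ with $|\xi|\ne1$, $$\hat u(t,\xi)=\frac{e^{-t|\xi|^2}-|\xi|^2e^{-t}}{1-|\xi|^2}\,\widehat{u_0}(\xi)+\frac{e^{-t|\xi|^2}-e^{-t}}{1-|\xi|^2}\,\widehat{u_1}(\xi).$$ Moments: for $v\in L^{1,k}(\mathbf{R}^n)$ and a multi-index $\alpha\in\mathbf{N}_0^n$ with $|\alpha|\le k$, $M_\alpha(v)=\frac{(-1)^{|\alpha|}}{\alpha!}\int_{\mathbf{R}^n}x^\alpha v(x)\,dx$. Profile functions: for $k\in\mathbf{N}_0$ and $v\in L^{1,k}(\mathbf{R}^n)$, $$A_k^v(\xi)=\sum_{j=0}^{k/2}|\xi|^{k-2j}\sum_{|\alpha|\le 2j}M_\alpha(v)(i\xi)^\alpha\quad(k\text{ even}),\qquad A_k^v(\xi)=\sum_{j=0}^{(k-1)/2}|\xi|^{k-1-2j}\sum_{|\alpha|\le 2j+1}M_\alpha(v)(i\xi)^\alpha\quad(k\text{ odd}),$$ with $A_{-1}^v\equiv0$, and $$B_k^v(\xi)=\sum_{j=0}^{k/2}|\xi|^{k-2j}\sum_{|\alpha|=2j}M_\alpha(v)(i\xi)^\alpha\quad(k\text{ even}),\qquad B_k^v(\xi)=\sum_{j=0}^{(k-1)/2}|\xi|^{k-1-2j}\sum_{|\alpha|=2j+1}M_\alpha(v)(i\xi)^\alpha\quad(k\text{ odd}).$$ *)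

theory Defs
  imports "HOL-Analysis.Analysis"
begin

text \<open>
  Functions on \<open>\<real>\<^sup>n\<close> have type \<open>real ^ 'n \<Rightarrow> complex\<close> with \<open>n = CARD('n) \<ge> 1\<close>; a multi-index in
  dimension \<open>n\<close> is a function \<open>'n \<Rightarrow> nat\<close>.
\<close>

definition L2 :: "(real ^ 'n \<Rightarrow> complex) set" where
  "L2 = {f \<in> borel_measurable lebesgue. integrable lebesgue (\<lambda>x. (cmod (f x))\<^sup>2)}"

text \<open>
  Real-valued, so the value is only meaningful if \<open>f\<close> is square integrable on \<open>S\<close>: finiteness of
  the norm has to be asserted separately.
\<close>

definition L2_norm_on :: "(real ^ 'n) set \<Rightarrow> (real ^ 'n \<Rightarrow> complex) \<Rightarrow> real" where
  "L2_norm_on S f = sqrt (LINT x:S|lebesgue. (cmod (f x))\<^sup>2)"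

abbreviation L2_norm :: "(real ^ 'n \<Rightarrow> complex) \<Rightarrow> real" where
  "L2_norm \<equiv> L2_norm_on UNIV"

definition L1_weighted :: "real \<Rightarrow> (real ^ 'n \<Rightarrow> complex) set" where
  "L1_weighted \<gamma> =
     {f. integrable lebesgue f \<and> integrable lebesgue (\<lambda>x. (1 + norm x) powr \<gamma> * cmod (f x))}"

text \<open>
  For \<open>f \<in> L\<^sup>1 \<inter> L\<^sup>2\<close> the extension of the Fourier transform to \<open>L\<^sup>2\<close> is given (almost everywhere)
  by the same integral.
\<close>

definition fourier :: "(real ^ 'n \<Rightarrow> complex) \<Rightarrow> real ^ 'n \<Rightarrow> complex" where
  "fourier f \<xi> = (LINT x|lebesgue. exp (- \<i> * complex_of_real (x \<bullet> \<xi>)) * f x)"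

text \<open>
  The Fourier transform in space of the solution of
  \<open>u\<^sub>t\<^sub>t - \<Delta>u + u\<^sub>t - \<Delta>u\<^sub>t = 0\<close>, \<open>u(0) = u0\<close>, \<open>u\<^sub>t(0) = u1\<close>.
  On the null set \<open>norm \<xi> = 1\<close> division by zero makes the value \<open>0\<close>.
\<close>

definition u_hat ::
  "(real ^ 'n \<Rightarrow> complex) \<Rightarrow> (real ^ 'n \<Rightarrow> complex) \<Rightarrow> real \<Rightarrow> real ^ 'n \<Rightarrow> complex" where
  "u_hat u0 u1 t \<xi> =
     complex_of_real ((exp (- t * (norm \<xi>)\<^sup>2) - (norm \<xi>)\<^sup>2 * exp (- t)) / (1 - (norm \<xi>)\<^sup>2))
       * fourier u0 \<xi>
   + complex_of_real ((exp (- t * (norm \<xi>)\<^sup>2) - exp (- t)) / (1 - (norm \<xi>)\<^sup>2))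
       * fourier u1 \<xi>"

definition mi_abs :: "('n::finite \<Rightarrow> nat) \<Rightarrow> nat" where
  "mi_abs \<alpha> = (\<Sum>i\<in>UNIV. \<alpha> i)"

definition mi_fact :: "('n::finite \<Rightarrow> nat) \<Rightarrow> nat" where
  "mi_fact \<alpha> = (\<Prod>i\<in>UNIV. fact (\<alpha> i))"

definition mi_power :: "'a::comm_semiring_1 ^ 'n \<Rightarrow> ('n::finite \<Rightarrow> nat) \<Rightarrow> 'a" where
  "mi_power x \<alpha> = (\<Prod>i\<in>UNIV. x $ i ^ \<alpha> i)"

text \<open>The sums over multi-indices below are therefore never degenerate.\<close>

lemma finite_mi_abs_le: "finite {\<alpha> :: 'n::finite \<Rightarrow> nat. mi_abs \<alpha> \<le> m}"
proof (rule finite_subset)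
  show "{\<alpha> :: 'n \<Rightarrow> nat. mi_abs \<alpha> \<le> m} \<subseteq> PiE UNIV (\<lambda>_. {..m})"
  proof
    fix \<alpha> :: "'n \<Rightarrow> nat"
    assume "\<alpha> \<in> {\<alpha>. mi_abs \<alpha> \<le> m}"
    then have "\<alpha> i \<le> m" for i
      using member_le_sum[of i UNIV \<alpha>] by (simp add: mi_abs_def)
    then show "\<alpha> \<in> PiE UNIV (\<lambda>_. {..m})"
      by auto
  qed
qed (simp add: finite_PiE)

lemma finite_mi_abs_eq: "finite {\<alpha> :: 'n::finite \<Rightarrow> nat. mi_abs \<alpha> = m}"
  by (rule finite_subset[OF _ finite_mi_abs_le[of m]]) auto

definition moment :: "('n::finite \<Rightarrow> nat) \<Rightarrow> (real ^ 'n \<Rightarrow> complex) \<Rightarrow> complex" where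
  "moment \<alpha> v =
     (- 1) ^ mi_abs \<alpha> / of_nat (mi_fact \<alpha>)
       * (LINT x|lebesgue. complex_of_real (mi_power x \<alpha>) * v x)"

definition i_times :: "real ^ 'n \<Rightarrow> complex ^ 'n" where
  "i_times \<xi> = (\<chi> l. \<i> * complex_of_real (\<xi> $ l))"

text \<open>
  The index is an integer so that \<open>A_profile (- 1)\<close> makes sense; it is \<open>0\<close> by convention.
\<close>

definition A_profile :: "int \<Rightarrow> (real ^ 'n \<Rightarrow> complex) \<Rightarrow> real ^ 'n \<Rightarrow> complex" where
  "A_profile k v \<xi> =
     (if k < 0 then 0
      else if even k then
        (\<Sum>j = 0..nat k div 2. complex_of_real (norm \<xi> ^ (nat k - 2 * j))
           * (\<Sum>\<alpha> | mi_abs \<alpha> \<le> 2 * j. moment \<alpha> v * mi_power (i_times \<xi>) \<alpha>))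
      else
        (\<Sum>j = 0..(nat k - 1) div 2. complex_of_real (norm \<xi> ^ (nat k - 1 - 2 * j))
           * (\<Sum>\<alpha> | mi_abs \<alpha> \<le> 2 * j + 1. moment \<alpha> v * mi_power (i_times \<xi>) \<alpha>)))"

definition B_profile :: "nat \<Rightarrow> (real ^ 'n \<Rightarrow> complex) \<Rightarrow> real ^ 'n \<Rightarrow> complex" where
  "B_profile k v \<xi> =
     (if even k then
        (\<Sum>j = 0..k div 2. complex_of_real (norm \<xi> ^ (k - 2 * j))
           * (\<Sum>\<alpha> | mi_abs \<alpha> = 2 * j. moment \<alpha> v * mi_power (i_times \<xi>) \<alpha>))
      else
        (\<Sum>j = 0..(k - 1) div 2. complex_of_real (norm \<xi> ^ (k - 1 - 2 * j))
           * (\<Sum>\<alpha> | mi_abs \<alpha> = 2 * j + 1. moment \<alpha> v * mi_power (i_times \<xi>) \<alpha>)))"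

end

theory Submission
  imports Defs "HOL-Probability.Characteristic_Functions" "HOL-Real_Asymp.Real_Asymp"
begin

text \<open>
  Near the origin the solution is \<open>exp (- t |\<xi>|\<^sup>2) * fourier v \<xi> / (1 - |\<xi>|\<^sup>2)\<close> up to an error of order
  \<open>exp (- t)\<close>. Multiplying the Taylor expansion of \<open>fourier v\<close> by the geometric series in \<open>|\<xi>|\<^sup>2\<close>,
  the part homogeneous of degree \<open>k\<close> is \<open>B_profile k v\<close> and the parts of lower degree add up to
  \<open>A_profile (k - 1) v\<close>. The remainder is at most \<open>\<epsilon> |\<xi>|\<^sup>k + C |\<xi>|\<^sup>k\<^sup>+\<^sup>1\<close> with \<open>\<epsilon>\<close> as small as desired; after the scaling
  \<open>\<xi> \<mapsto> \<xi> / sqrt t\<close> it is negligible in \<open>L\<^sup>2\<close> against the contribution of \<open>B_profile k v\<close>. Away from the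
  origin everything decays exponentially in \<open>t\<close>, since the Fourier transforms of the data
  are square integrable; the latter follows by inserting a Gaussian factor \<open>exp (- |c \<xi>|\<^sup>2 / 2)\<close>, whose Fourier
  transform has an \<open>L\<^sup>1\<close> norm independent of \<open>c\<close>, and letting \<open>c\<close> tend to \<open>0\<close>.
\<close>

section \<open>Gaussian integrals on Euclidean space\<close>

text \<open>The data have only k absolute moments, so the Taylor remainder of order k is
  o(|\<xi>|^k) with no rate. After scaling it carries the same power of t as the contribution of
  \<open>B_profile k v\<close>; only the smallness of \<epsilon> separates the two. Hence \<epsilon>
  is fixed once the Gaussian-weighted L2 norm of \<open>B_profile k v\<close> is known, and \<delta>
  after \<epsilon>. All comparisons are between squared norms, through |a + b|^2 \<le> 2 |a|^2 + 2
  |b|^2. Keeping the squared remainder below a quarter of the squared leading part leaves at least a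
  quarter of the latter, and the square root of that quarter is the factor 1/2 of the lower bound.
  The comparison runs over the whole space, whose integral dominates the one over |\<xi>| \<le> 1/2.
  If the leading part vanishes almost everywhere, the lower bound is trivial. The singularity of the
  symbols at |\<xi>| = 1 is removable: outside the ball of radius 1/2 the quotients are treated as
  difference quotients of the exponential, and the decay rate 1/4 is the square of that
  radius.\<close>

lemma
  fixes f :: "'a::euclidean_space \<Rightarrow> real \<Rightarrow> 'b::{real_normed_field, banach, second_countable_topology}"
  assumes f: "\<And>b. b \<in> Basis \<Longrightarrow> integrable lborel (f b)"
  shows integrable_lborel_prod: "integrable lborel (\<lambda>x::'a. \<Prod>b\<in>Basis. f b (x \<bullet> b))" (is ?int)
    and integral_lborel_prod:
      "(\<integral>x. (\<Prod>b\<in>Basis. f b (x \<bullet> b)) \<partial>lborel) = (\<Prod>b\<in>Basis. \<integral>x. f b x \<partial>lborel)" (is ?eq)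
proof -
  interpret product_sigma_finite "\<lambda>_::'a. lborel :: real measure" ..
  let ?s = "\<lambda>g. \<Sum>b\<in>Basis. g b *\<^sub>R b :: 'a"
  have [measurable]: "f b \<in> borel_measurable borel" if "b \<in> Basis" for b
    using borel_measurable_integrable[OF f[OF that]] by simp
  have s: "?s \<in> (\<Pi>\<^sub>M b\<in>Basis. lborel) \<rightarrow>\<^sub>M borel"
    by measurable
  have F: "(\<lambda>x::'a. \<Prod>b\<in>Basis. f b (x \<bullet> b)) \<in> borel_measurable borel"
    by measurable
  have comp: "(\<Prod>b\<in>Basis. f b (?s g \<bullet> b)) = (\<Prod>b\<in>Basis. f b (g b))" for g
    by (intro prod.cong refl) simp
  show ?int
    unfolding lborel_eq[where 'a='a] by (subst integrable_distr_eq[OF s F], unfold comp) (rule product_integrable_prod, simp_all add: f)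
  show ?eq
    unfolding lborel_eq[where 'a='a]
    by (subst integral_distr[OF s F], unfold comp) (rule product_integral_prod, simp_all add: f)
qed

text \<open>The value comes from the characteristic function of the standard normal distribution,
  with the factor 1 / sqrt (2 pi) of its density undone.\<close>

lemma has_bochner_integral_gaussian_iexp:
  "has_bochner_integral lborel (\<lambda>x. of_real (exp (- x\<^sup>2 / 2)) * iexp (t * x)) (of_real (sqrt (2 * pi) * exp (- t\<^sup>2 / 2)))"
proof -
  have int: "integrable lborel (\<lambda>x. of_real (exp (- x\<^sup>2 / 2)) * iexp (t * x))"
  proof (rule Bochner_Integration.integrable_bound)
    have "integrable lborel (\<lambda>x. sqrt (2 * pi) * std_normal_density x)"
      by simp
    then show "integrable lborel (\<lambda>x::real. exp (- x\<^sup>2 / 2))"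
      by (simp add: std_normal_density_def)
  qed (auto simp: norm_mult)
  have "of_real (exp (- (t\<^sup>2) / 2)) = char std_normal_distribution t"
    by (simp add: char_std_normal_distribution)
  also have "\<dots> = (\<integral>x. std_normal_density x *\<^sub>R iexp (t * x) \<partial>lborel)"
    unfolding char_def by (subst integral_density) (auto simp: mult.commute)
  also have "\<dots> = (\<integral>x. of_real (1 / sqrt (2 * pi)) * (of_real (exp (- x\<^sup>2 / 2)) * iexp (t * x)) \<partial>lborel)"
    by (intro Bochner_Integration.integral_cong)
      (auto simp: std_normal_density_def scaleR_conv_of_real)
  also have "\<dots> = of_real (1 / sqrt (2 * pi)) * (\<integral>x. of_real (exp (- x\<^sup>2 / 2)) * iexp (t * x) \<partial>lborel)"
    by (rule integral_mult_right_zero)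
  finally show ?thesis
    using int by (simp add: has_bochner_integral_iff field_simps)
qed

lemma norm_power2_eq_sum_Basis: "(norm (x::'a::euclidean_space))\<^sup>2 = (\<Sum>b\<in>Basis. (x \<bullet> b)\<^sup>2)"
  by (subst power2_norm_eq_inner, subst euclidean_inner) (simp add: power2_eq_square)

lemma exp_norm_power2_eq_prod_Basis:
  "exp (- (norm (x::'a::euclidean_space))\<^sup>2 / 2) = (\<Prod>b\<in>Basis. exp (- (x \<bullet> b)\<^sup>2 / 2))"
proof -
  have "- (norm x)\<^sup>2 / 2 = (\<Sum>b\<in>Basis. - (x \<bullet> b)\<^sup>2 / 2)"
    unfolding norm_power2_eq_sum_Basis by (simp add: sum_divide_distrib[symmetric] sum_negf)
  then show ?thesis
    by (simp add: exp_sum)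
qed

text \<open>Both |y|^2 and the inner product are sums over \<open>Basis\<close>, so the integrand is
  a product of one-dimensional Gaussians with frequencies \<open>x \<bullet> b\<close>.\<close>

lemma has_bochner_integral_gaussian_euclidean:
  fixes x :: "'a::euclidean_space"
  shows "has_bochner_integral lborel
      (\<lambda>y::'a. of_real (exp (- (norm y)\<^sup>2 / 2)) * iexp (x \<bullet> y))
      (of_real (sqrt (2 * pi) ^ DIM('a) * exp (- (norm x)\<^sup>2 / 2)))"
proof -
  let ?f = "\<lambda>b y. complex_of_real (exp (- y\<^sup>2 / 2)) * iexp ((x \<bullet> b) * y)"
  have iexp: "iexp (x \<bullet> y) = (\<Prod>b\<in>Basis. iexp ((x \<bullet> b) * (y \<bullet> b)))" for y
    by (subst euclidean_inner) (simp add: sum_distrib_left exp_sum)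
  have eq: "(\<lambda>y::'a. complex_of_real (exp (- (norm y)\<^sup>2 / 2)) * iexp (x \<bullet> y)) = (\<lambda>y. \<Prod>b\<in>Basis. ?f b (y \<bullet> b))"
    unfolding exp_norm_power2_eq_prod_Basis iexp of_real_prod prod.distrib ..
  have i: "integrable lborel (?f b)" and v: "integral\<^sup>L lborel (?f b) = of_real (sqrt (2 * pi) * exp (- (x \<bullet> b)\<^sup>2 / 2))" for b
    using has_bochner_integral_gaussian_iexp[of "x \<bullet> b"] by (auto simp: has_bochner_integral_iff)
  have val: "(\<Prod>b\<in>Basis. complex_of_real (sqrt (2 * pi) * exp (- (x \<bullet> b)\<^sup>2 / 2))) =
      of_real (sqrt (2 * pi) ^ DIM('a) * exp (- (norm x)\<^sup>2 / 2))"
    unfolding exp_norm_power2_eq_prod_Basis of_real_prod[symmetric] prod.distrib prod_constant ..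
  show ?thesis
    unfolding eq has_bochner_integral_iff
    by (intro conjI integrable_lborel_prod i, subst integral_lborel_prod[OF i], unfold v) (rule val)
qed

lemma integrable_gaussian_euclidean:
  "integrable lborel (\<lambda>y::'a::euclidean_space. exp (- (norm y)\<^sup>2 / 2))"
proof -
  have "integrable lborel (\<lambda>y::'a. complex_of_real (exp (- (norm y)\<^sup>2 / 2)))"
    using has_bochner_integral_gaussian_euclidean[of "0::'a"] by (simp add: has_bochner_integral_iff)
  then show ?thesis
    unfolding complex_of_real_integrable_eq .
qed

section \<open>The Fourier integral is bounded on L2\<close>

lemma has_bochner_integral_lborel_scaleR:
  fixes f :: "'a::euclidean_space \<Rightarrow> 'b::{banach, second_countable_topology}"
  assumes f: "has_bochner_integral lborel f I" and c: "c \<noteq> 0"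
  shows "has_bochner_integral lborel (\<lambda>x. f (c *\<^sub>R x)) (I /\<^sub>R \<bar>c\<bar> ^ DIM('a))"
proof -
  have [measurable]: "f \<in> borel_measurable borel"
    using f by (auto simp: has_bochner_integral_iff dest: borel_measurable_integrable)
  have "has_bochner_integral (density (distr lborel borel (\<lambda>x::'a. c *\<^sub>R x)) (\<lambda>_. \<bar>c\<bar> ^ DIM('a))) f I"
    using f lborel_affine[of c "0::'a"] c by simp
  then have *: "has_bochner_integral (distr lborel borel (\<lambda>x::'a. c *\<^sub>R x)) (\<lambda>x. \<bar>c\<bar> ^ DIM('a) *\<^sub>R f x) I"
    by (auto simp: has_bochner_integral_iff integrable_density integral_density)
  then have "has_bochner_integral lborel (\<lambda>x::'a. \<bar>c\<bar> ^ DIM('a) *\<^sub>R f (c *\<^sub>R x)) I"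
    by (auto simp: has_bochner_integral_iff integrable_distr_eq integral_distr)
  from has_bochner_integral_scaleR_right[OF this, of "inverse (\<bar>c\<bar> ^ DIM('a))"] show ?thesis
    using c by simp
qed

text \<open>A non-integrable function has Bochner integral \<open>0\<close> by default, so that case
  is trivial.\<close>

lemma norm_integral_le_nn_integral:
  fixes f :: "'a \<Rightarrow> 'b::{banach, second_countable_topology}"
  shows "ennreal (norm (\<integral>x. f x \<partial>M)) \<le> (\<integral>\<^sup>+x. ennreal (norm (f x)) \<partial>M)"
  by (cases "integrable M f") (simp_all add: integral_norm_bound_ennreal not_integrable_integral_eq)

lemma integrable_lborel_pair_mult:
  fixes g :: "'a::euclidean_space \<Rightarrow> real" and h :: "'b::euclidean_space \<Rightarrow> real"
  assumes g: "integrable lborel g" and h: "integrable lborel h"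
  shows "integrable (lborel \<Otimes>\<^sub>M lborel) (\<lambda>(x, y). g x * h y)"
proof -
  note [measurable] = borel_measurable_integrable[OF g] borel_measurable_integrable[OF h]
  show ?thesis
  proof (rule lborel_pair.Fubini_integrable)
    show "AE x in lborel. integrable lborel (\<lambda>y. case (x, y) of (x, y) \<Rightarrow> g x * h y)"
      using h by simp
    have "integrable lborel (\<lambda>x. \<bar>g x\<bar> * (\<integral>y. \<bar>h y\<bar> \<partial>lborel))"
      using g by simp
    then show "integrable lborel (\<lambda>x. \<integral>y. norm (case (x, y) of (x, y) \<Rightarrow> g x * h y) \<partial>lborel)"
      by (simp add: abs_mult)
  qed measurable
qed

context
  fixes f :: "'a::euclidean_space \<Rightarrow> complex"
  assumes f: "integrable lborel f"
begin

lemma borel_measurable_integrable_lborel [measurable]: "f \<in> borel_measurable borel"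
  using borel_measurable_integrable[OF f] by simp

lemma borel_measurable_Fourier_integral [measurable]:
  "(\<lambda>\<xi>. \<integral>x. iexp (- (x \<bullet> \<xi>)) * f x \<partial>lborel) \<in> borel_measurable borel"
  by measurable

lemma norm_Fourier_integral_le: "norm (\<integral>x. iexp (- (x \<bullet> \<xi>)) * f x \<partial>lborel) \<le> (\<integral>x. norm (f x) \<partial>lborel)"
  using integral_norm_bound[of lborel "\<lambda>x. iexp (- (x \<bullet> \<xi>)) * f x"] by (simp add: norm_mult)

lemma integrable_mult_norm_Fourier_integral_sq:
  assumes G: "integrable lborel (G :: 'a \<Rightarrow> real)"
  shows "integrable lborel (\<lambda>\<xi>. G \<xi> * (norm (\<integral>x. iexp (- (x \<bullet> \<xi>)) * f x \<partial>lborel))\<^sup>2)"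
proof (rule Bochner_Integration.integrable_bound)
  note [measurable] = borel_measurable_integrable[OF G]
  show "integrable lborel (\<lambda>\<xi>. G \<xi> * (\<integral>x. norm (f x) \<partial>lborel)\<^sup>2)"
    using G by simp
  show "(\<lambda>\<xi>. G \<xi> * (norm (\<integral>x. iexp (- (x \<bullet> \<xi>)) * f x \<partial>lborel))\<^sup>2) \<in> borel_measurable lborel"
    by measurable
  show "AE \<xi> in lborel. norm (G \<xi> * (norm (\<integral>x. iexp (- (x \<bullet> \<xi>)) * f x \<partial>lborel))\<^sup>2)
      \<le> norm (G \<xi> * (\<integral>x. norm (f x) \<partial>lborel)\<^sup>2)"
    using norm_Fourier_integral_le by (auto simp: abs_mult intro!: mult_left_mono power_mono)
qed

text \<open>Write |F|^2 as cnj F * F and unfold both factors. Since \<open>f\<close> is only in L1,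
  its transform is merely bounded; the integrable weight \<open>G\<close> is what makes the
  integrals converge absolutely and both exchanges legitimate. What ends up innermost is the Fourier
  transform of \<open>G\<close> at \<open>y - x\<close>.\<close>

lemma integral_mult_norm_Fourier_integral_sq:
  assumes G: "integrable lborel (G :: 'a \<Rightarrow> real)"
  shows "complex_of_real (\<integral>\<xi>. G \<xi> * (norm (\<integral>x. iexp (- (x \<bullet> \<xi>)) * f x \<partial>lborel))\<^sup>2 \<partial>lborel) =
    (\<integral>x. f x * (\<integral>y. cnj (f y) * (\<integral>\<xi>. G \<xi> * iexp ((y - x) \<bullet> \<xi>) \<partial>lborel) \<partial>lborel) \<partial>lborel)"
proof -
  note [measurable] = borel_measurable_integrable[OF G]
  have [measurable]: "cnj \<in> borel_measurable borel"
    by (intro borel_measurable_continuous_onI continuous_intros)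
  define F where "F \<xi> = (\<integral>x. iexp (- (x \<bullet> \<xi>)) * f x \<partial>lborel)" for \<xi>
  define M where "M = (\<integral>x. norm (f x) \<partial>lborel)"
  have F[measurable]: "F \<in> borel_measurable borel"
    unfolding F_def by measurable
  have FM: "norm (F \<xi>) \<le> M" for \<xi>
    unfolding F_def M_def by (rule norm_Fourier_integral_le)
  have M0: "0 \<le> M"
    by (simp add: M_def)
  \<comment> \<open>\<open>bound\<close> justifies the exchange of \<xi> and x, with the other copy
    of F replaced by its supremum bound \<open>M\<close>; \<open>bound'\<close> justifies the
    exchange of \<xi> and y.\<close>
  have bound: "integrable (lborel \<Otimes>\<^sub>M lborel) (\<lambda>(\<xi>, x). (G \<xi> * M) * norm (f x))"
    using G f by (intro integrable_lborel_pair_mult) auto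
  have bound': "integrable (lborel \<Otimes>\<^sub>M lborel) (\<lambda>(\<xi>, y). G \<xi> * norm (f y))"
    using G f by (intro integrable_lborel_pair_mult) auto
  have cnjF: "cnj (F \<xi>) = (\<integral>y. iexp (y \<bullet> \<xi>) * cnj (f y) \<partial>lborel)" for \<xi>
    unfolding F_def by (subst Bochner_Integration.integral_cnj[symmetric]) (simp add: exp_cnj)
  have inner: "(\<integral>\<xi>. G \<xi> * cnj (F \<xi>) * iexp (- (x \<bullet> \<xi>)) \<partial>lborel) =
      (\<integral>y. cnj (f y) * (\<integral>\<xi>. G \<xi> * iexp ((y - x) \<bullet> \<xi>) \<partial>lborel) \<partial>lborel)" for x
  proof -
    have "(\<integral>\<xi>. G \<xi> * cnj (F \<xi>) * iexp (- (x \<bullet> \<xi>)) \<partial>lborel) =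
      (\<integral>\<xi>. (\<integral>y. G \<xi> * iexp ((y - x) \<bullet> \<xi>) * cnj (f y) \<partial>lborel) \<partial>lborel)"
    proof (intro Bochner_Integration.integral_cong refl)
      fix \<xi>
      have "G \<xi> * cnj (F \<xi>) * iexp (- (x \<bullet> \<xi>)) =
          (\<integral>y. (G \<xi> * iexp (- (x \<bullet> \<xi>))) * (iexp (y \<bullet> \<xi>) * cnj (f y)) \<partial>lborel)"
        unfolding cnjF by (subst integral_mult_right_zero) (simp add: mult_ac)
      also have "(\<lambda>y. (G \<xi> * iexp (- (x \<bullet> \<xi>))) * (iexp (y \<bullet> \<xi>) * cnj (f y))) =
          (\<lambda>y. G \<xi> * iexp ((y - x) \<bullet> \<xi>) * cnj (f y))"
        by (simp add: fun_eq_iff inner_diff_left algebra_simps exp_diff exp_minus divide_inverse)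
      finally show "G \<xi> * cnj (F \<xi>) * iexp (- (x \<bullet> \<xi>)) = (\<integral>y. G \<xi> * iexp ((y - x) \<bullet> \<xi>) * cnj (f y) \<partial>lborel)" .
    qed
    also have "\<dots> = (\<integral>y. (\<integral>\<xi>. G \<xi> * iexp ((y - x) \<bullet> \<xi>) * cnj (f y) \<partial>lborel) \<partial>lborel)"
      by (rule lborel_pair.Fubini_integral[symmetric], rule Bochner_Integration.integrable_bound[OF bound'])
        (auto simp: norm_mult)
    finally show ?thesis
      by (simp add: mult.commute)
  qed
  have "complex_of_real (\<integral>\<xi>. G \<xi> * (norm (F \<xi>))\<^sup>2 \<partial>lborel) =
      (\<integral>\<xi>. G \<xi> * cnj (F \<xi>) * F \<xi> \<partial>lborel)"
    unfolding integral_complex_of_real[symmetric]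
    by (intro Bochner_Integration.integral_cong refl) (simp add: complex_norm_square[unfolded of_real_power] mult_ac)
  also have "\<dots> = (\<integral>\<xi>. (\<integral>x. G \<xi> * cnj (F \<xi>) * (iexp (- (x \<bullet> \<xi>)) * f x) \<partial>lborel) \<partial>lborel)"
    by (simp only: integral_mult_right_zero F_def)
  also have "\<dots> = (\<integral>x. (\<integral>\<xi>. G \<xi> * cnj (F \<xi>) * (iexp (- (x \<bullet> \<xi>)) * f x) \<partial>lborel) \<partial>lborel)"
    by (rule lborel_pair.Fubini_integral[symmetric], rule Bochner_Integration.integrable_bound[OF bound])
      (auto simp: norm_mult abs_mult FM M0 intro!: AE_I2 mult_mono)
  also have "\<dots> = (\<integral>x. f x * (\<integral>\<xi>. G \<xi> * cnj (F \<xi>) * iexp (- (x \<bullet> \<xi>)) \<partial>lborel) \<partial>lborel)"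
    unfolding integral_mult_right_zero[symmetric] by (simp only: mult_ac)
  finally show ?thesis
    unfolding inner unfolding F_def .
qed

lemma nn_integral_lborel_shift:
  fixes g :: "'a \<Rightarrow> ennreal"
  assumes [measurable]: "g \<in> borel_measurable borel"
  shows "(\<integral>\<^sup>+y. g (y - x) \<partial>lborel) = (\<integral>\<^sup>+y. g y \<partial>lborel)"
proof -
  have "(\<integral>\<^sup>+y. g y \<partial>lborel) = (\<integral>\<^sup>+y. g y \<partial>distr lborel borel ((+) (- x)))"
    by (simp add: lborel_distr_plus)
  also have "\<dots> = (\<integral>\<^sup>+y. g (y - x) \<partial>lborel)"
    by (subst nn_integral_distr) simp_all
  finally show ?thesis ..
qed

text \<open>Schur's test, with the kernel bounded through \<open>2 a b \<le> a\<^sup>2 + b\<^sup>2\<close>.\<close>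

lemma nn_integral_convolution_le:
  assumes K[measurable]: "K \<in> borel_measurable borel" and K0: "\<And>z::'a. 0 \<le> (K z :: real)" and Keven: "\<And>z. K (- z) = K z"
  shows "(\<integral>\<^sup>+x. ennreal (norm (f x)) * (\<integral>\<^sup>+y. ennreal (norm (f y) * K (y - x)) \<partial>lborel) \<partial>lborel)
    \<le> (\<integral>\<^sup>+z. K z \<partial>lborel) * (\<integral>\<^sup>+x. ennreal ((norm (f x))\<^sup>2) \<partial>lborel)"
proof -
  let ?A = "\<integral>\<^sup>+x. (\<integral>\<^sup>+y. ennreal ((norm (f x))\<^sup>2 / 2) * K (y - x) \<partial>lborel) \<partial>lborel"
  let ?B = "\<integral>\<^sup>+x. (\<integral>\<^sup>+y. ennreal ((norm (f y))\<^sup>2 / 2) * K (y - x) \<partial>lborel) \<partial>lborel"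
  have "(\<integral>\<^sup>+x. ennreal (norm (f x)) * (\<integral>\<^sup>+y. ennreal (norm (f y) * K (y - x)) \<partial>lborel) \<partial>lborel)
      = (\<integral>\<^sup>+x. (\<integral>\<^sup>+y. ennreal (norm (f x)) * ennreal (norm (f y) * K (y - x)) \<partial>lborel) \<partial>lborel)"
    by (intro nn_integral_cong nn_integral_cmult[symmetric]) measurable
  also have "\<dots> \<le> (\<integral>\<^sup>+x. (\<integral>\<^sup>+y. ennreal ((norm (f x))\<^sup>2 / 2) * K (y - x) + ennreal ((norm (f y))\<^sup>2 / 2) * K (y - x) \<partial>lborel) \<partial>lborel)"
  proof (intro nn_integral_mono)
    fix x y
    have "norm (f x) * norm (f y) \<le> (norm (f x))\<^sup>2 / 2 + (norm (f y))\<^sup>2 / 2"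
      using sum_squares_bound[of "norm (f x)" "norm (f y)"] by simp
    then have "norm (f x) * (norm (f y) * K (y - x)) \<le> ((norm (f x))\<^sup>2 / 2 + (norm (f y))\<^sup>2 / 2) * K (y - x)"
      unfolding mult.assoc[symmetric] by (intro mult_right_mono K0)
    then show "ennreal (norm (f x)) * ennreal (norm (f y) * K (y - x))
        \<le> ennreal ((norm (f x))\<^sup>2 / 2) * K (y - x) + ennreal ((norm (f y))\<^sup>2 / 2) * K (y - x)"
      using K0 by (simp add: ennreal_mult[symmetric] ennreal_plus[symmetric] distrib_right del: ennreal_plus)
  qed
  also have "\<dots> = ?A + ?B"
    by (simp add: nn_integral_add)
  also have "?B = (\<integral>\<^sup>+y. (\<integral>\<^sup>+x. ennreal ((norm (f y))\<^sup>2 / 2) * K (y - x) \<partial>lborel) \<partial>lborel)"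
    by (rule lborel_pair.Fubini') measurable
  also have "\<dots> = ?A"
    \<comment> \<open>After the exchange the two variables have swapped roles in the difference;
      evenness of \<open>K\<close> restores it.\<close>
    by (intro nn_integral_cong arg_cong2[where f="(*)"] arg_cong[where f=ennreal] refl)
      (subst Keven[symmetric], simp)
  also have "?A = (\<integral>\<^sup>+x. ennreal ((norm (f x))\<^sup>2 / 2) * (\<integral>\<^sup>+z. K z \<partial>lborel) \<partial>lborel)"
    by (simp add: nn_integral_cmult nn_integral_lborel_shift[where g="\<lambda>z. ennreal (K z)"])
  also have "\<dots> = (\<integral>\<^sup>+z. K z \<partial>lborel) * (\<integral>\<^sup>+x. ennreal ((norm (f x))\<^sup>2 / 2) \<partial>lborel)"
    by (subst nn_integral_multc) (simp_all add: mult.commute)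
  also have "\<dots> + \<dots> = (\<integral>\<^sup>+z. K z \<partial>lborel) * (\<integral>\<^sup>+x. ennreal ((norm (f x))\<^sup>2) \<partial>lborel)"
    unfolding distrib_left[symmetric] by (subst nn_integral_add[symmetric]) (simp_all flip: ennreal_plus)
  finally show ?thesis .
qed

lemma gaussian_mult_norm_Fourier_integral_sq_le:
  assumes c: "c > 0"
  shows "(\<integral>\<^sup>+\<xi>. ennreal (exp (- (norm (c *\<^sub>R \<xi>))\<^sup>2 / 2) * (norm (\<integral>x. iexp (- (x \<bullet> \<xi>)) * f x \<partial>lborel))\<^sup>2) \<partial>lborel)
    \<le> ennreal ((2 * pi) ^ DIM('a)) * (\<integral>\<^sup>+x. ennreal ((norm (f x))\<^sup>2) \<partial>lborel)"
proof -
  define G where "G \<xi> = exp (- (norm (c *\<^sub>R \<xi>))\<^sup>2 / 2)" for \<xi> :: 'a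
  \<comment> \<open>The Fourier transform of \<open>G\<close>, found by dilating the standard
    Gaussian; the denominator is the Jacobian of the dilation.\<close>
  define K where "K z = sqrt (2 * pi) ^ DIM('a) * exp (- (norm (z /\<^sub>R c))\<^sup>2 / 2) / c ^ DIM('a)" for z :: 'a
  have hbi: "has_bochner_integral lborel (\<lambda>\<xi>. G \<xi> * iexp (z \<bullet> \<xi>)) (of_real (K z))" for z
    using has_bochner_integral_lborel_scaleR[OF has_bochner_integral_gaussian_euclidean[of "z /\<^sub>R c"], of c] c
    by (simp add: G_def K_def field_simps scaleR_conv_of_real)
  have G: "integrable lborel G"
    using hbi[of 0] by (simp add: has_bochner_integral_iff complex_of_real_integrable_eq)
  have "has_bochner_integral lborel (\<lambda>y::'a. exp (- (norm y)\<^sup>2 / 2)) (sqrt (2 * pi) ^ DIM('a))"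
    using has_bochner_integral_gaussian_euclidean[of "0::'a"]
    by (simp add: has_bochner_integral_iff complex_of_real_integrable_eq flip: of_real_power of_real_mult)
  from has_bochner_integral_lborel_scaleR[OF this, of "inverse c"] c
  have "has_bochner_integral lborel (\<lambda>y::'a. exp (- (norm (y /\<^sub>R c))\<^sup>2 / 2)) (sqrt (2 * pi) ^ DIM('a) * c ^ DIM('a))"
    by (simp add: power_inverse mult.commute)
  then have "has_bochner_integral lborel (\<lambda>y::'a. sqrt (2 * pi) ^ DIM('a) / c ^ DIM('a) * exp (- (norm (y /\<^sub>R c))\<^sup>2 / 2))
      (sqrt (2 * pi) ^ DIM('a) / c ^ DIM('a) * (sqrt (2 * pi) ^ DIM('a) * c ^ DIM('a)))"
    by (rule has_bochner_integral_mult_right)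
  \<comment> \<open>The powers of c cancel. Fourier inversion predicts the same value: the mass of
    \<open>K\<close> is (2 pi)^n G(0), and G(0) = 1.\<close>
  moreover have "sqrt (2 * pi) ^ DIM('a) / c ^ DIM('a) * (sqrt (2 * pi) ^ DIM('a) * c ^ DIM('a)) = (sqrt (2 * pi) * sqrt (2 * pi)) ^ DIM('a)"
    unfolding power_mult_distrib using c by simp
  ultimately have "has_bochner_integral lborel K ((2 * pi) ^ DIM('a))"
    unfolding K_def by simp
  then have Kint: "(\<integral>\<^sup>+z. K z \<partial>lborel) = ennreal ((2 * pi) ^ DIM('a))"
    using c by (subst nn_integral_eq_integral) (auto simp: has_bochner_integral_iff K_def)
  define F where "F \<xi> = (\<integral>x. iexp (- (x \<bullet> \<xi>)) * f x \<partial>lborel)" for \<xi>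
  have "(\<integral>\<^sup>+\<xi>. ennreal (G \<xi> * (norm (F \<xi>))\<^sup>2) \<partial>lborel) = ennreal (\<integral>\<xi>. G \<xi> * (norm (F \<xi>))\<^sup>2 \<partial>lborel)"
    unfolding F_def by (intro nn_integral_eq_integral integrable_mult_norm_Fourier_integral_sq G) (auto simp: G_def)
  also have "\<dots> = ennreal (norm (complex_of_real (\<integral>\<xi>. G \<xi> * (norm (F \<xi>))\<^sup>2 \<partial>lborel)))"
    by (simp add: G_def)
  also have "\<dots> = ennreal (norm (\<integral>x. f x * (\<integral>y. cnj (f y) * of_real (K (y - x)) \<partial>lborel) \<partial>lborel))"
    unfolding F_def integral_mult_norm_Fourier_integral_sq[OF G] has_bochner_integral_integral_eq[OF hbi] ..
  also have "\<dots> \<le> (\<integral>\<^sup>+x. ennreal (norm (f x * (\<integral>y. cnj (f y) * of_real (K (y - x)) \<partial>lborel))) \<partial>lborel)"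
    by (rule norm_integral_le_nn_integral)
  also have "\<dots> \<le> (\<integral>\<^sup>+x. ennreal (norm (f x)) * (\<integral>\<^sup>+y. ennreal (norm (f y) * K (y - x)) \<partial>lborel) \<partial>lborel)"
  proof (rule nn_integral_mono)
    fix x
    have "0 \<le> K z" for z
      using c by (simp add: K_def)
    then have "ennreal (norm (\<integral>y. cnj (f y) * of_real (K (y - x)) \<partial>lborel)) \<le> (\<integral>\<^sup>+y. ennreal (norm (f y) * K (y - x)) \<partial>lborel)"
      using norm_integral_le_nn_integral[of lborel "\<lambda>y. cnj (f y) * of_real (K (y - x))"] by (simp add: norm_mult)
    then show "ennreal (norm (f x * (\<integral>y. cnj (f y) * of_real (K (y - x)) \<partial>lborel)))
        \<le> ennreal (norm (f x)) * (\<integral>\<^sup>+y. ennreal (norm (f y) * K (y - x)) \<partial>lborel)"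
      by (simp add: norm_mult ennreal_mult mult_left_mono)
  qed
  also have "\<dots> \<le> (\<integral>\<^sup>+z. K z \<partial>lborel) * (\<integral>\<^sup>+x. ennreal ((norm (f x))\<^sup>2) \<partial>lborel)"
    using c by (intro nn_integral_convolution_le) (auto simp: K_def[abs_def])
  finally show ?thesis
    unfolding Kint G_def F_def .
qed

lemma nn_integral_norm_Fourier_integral_sq_le:
  "(\<integral>\<^sup>+\<xi>. ennreal ((norm (\<integral>x. iexp (- (x \<bullet> \<xi>)) * f x \<partial>lborel))\<^sup>2) \<partial>lborel)
    \<le> ennreal ((2 * pi) ^ DIM('a)) * (\<integral>\<^sup>+x. ennreal ((norm (f x))\<^sup>2) \<partial>lborel)" (is "_ \<le> ?R")
proof -
  define F where "F \<xi> = (\<integral>x. iexp (- (x \<bullet> \<xi>)) * f x \<partial>lborel)" for \<xi>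
  have F[measurable]: "F \<in> borel_measurable borel"
    unfolding F_def by measurable
  define u where "u n \<xi> = ennreal (exp (- (norm (inverse (real (Suc n)) *\<^sub>R \<xi>))\<^sup>2 / 2) * (norm (F \<xi>))\<^sup>2)" for n and \<xi> :: 'a
  have lim: "(\<lambda>n. u n \<xi>) \<longlonglongrightarrow> ennreal ((norm (F \<xi>))\<^sup>2)" for \<xi>
  proof -
    have "(\<lambda>n. exp (- (norm (inverse (real (Suc n)) *\<^sub>R \<xi>))\<^sup>2 / 2) * (norm (F \<xi>))\<^sup>2) \<longlonglongrightarrow>
        exp (- (norm (0 *\<^sub>R \<xi>))\<^sup>2 / 2) * (norm (F \<xi>))\<^sup>2"
      by (intro tendsto_intros LIMSEQ_inverse_real_of_nat) simp
    then show ?thesis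
      unfolding u_def by (intro tendsto_ennrealI) simp
  qed
  have "(\<integral>\<^sup>+\<xi>. ennreal ((norm (F \<xi>))\<^sup>2) \<partial>lborel) = (\<integral>\<^sup>+\<xi>. liminf (\<lambda>n. u n \<xi>) \<partial>lborel)"
    using lim by (intro nn_integral_cong lim_imp_Liminf[symmetric]) auto
  also have "\<dots> \<le> liminf (\<lambda>n. \<integral>\<^sup>+\<xi>. u n \<xi> \<partial>lborel)"
    by (rule nn_integral_liminf) (auto simp: u_def)
  also have "\<dots> \<le> ?R"
    unfolding u_def F_def by (intro Liminf_le eventuallyI gaussian_mult_norm_Fourier_integral_sq_le) simp_all
  finally show ?thesis
    unfolding F_def .
qed

end

section \<open>Passage from Lebesgue measurable data to Borel versions\<close>

lemma lebesgue_ex_borel_measurable_complex: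
  fixes f :: "'a::euclidean_space \<Rightarrow> complex"
  assumes [measurable]: "f \<in> borel_measurable lebesgue"
  obtains g where "g \<in> borel_measurable borel" "AE x in lborel. f x = g x"
proof -
  have "(\<lambda>x. Re (f x)) \<in> borel_measurable lebesgue" "(\<lambda>x. Im (f x)) \<in> borel_measurable lebesgue"
    by measurable
  then obtain g h where gh: "g \<in> borel_measurable lborel" "h \<in> borel_measurable lborel"
      "AE x in lborel. Re (f x) = g x" "AE x in lborel. Im (f x) = h x"
    by (blast dest: completion_ex_borel_measurable_real)
  show thesis
  proof
    show "(\<lambda>x. Complex (g x) (h x)) \<in> borel_measurable borel"
      using gh by (simp add: Complex_eq)
    show "AE x in lborel. f x = Complex (g x) (h x)"
      using gh(3,4) by eventually_elim (simp add: complex_eq_iff)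
  qed
qed

text \<open>The Fubini arguments above live on \<open>lborel\<close>, while the data are only
  Lebesgue measurable. Changing the data on a null set alters no Fourier integral, so the identity
  holds at every \<xi>.\<close>

lemma fourier_eq_lborel:
  fixes f :: "real ^ 'n \<Rightarrow> complex"
  assumes f: "integrable lebesgue f"
  obtains g where "integrable lborel g" "AE x in lborel. f x = g x"
    "fourier f = (\<lambda>\<xi>. \<integral>x. iexp (- (x \<bullet> \<xi>)) * g x \<partial>lborel)"
proof -
  obtain g where g[measurable]: "g \<in> borel_measurable borel" and fg: "AE x in lborel. f x = g x"
    using lebesgue_ex_borel_measurable_complex borel_measurable_integrable[OF f] by blast
  have [measurable]: "f \<in> borel_measurable lebesgue" and [measurable]: "g \<in> borel_measurable lebesgue"
    using f g by (auto simp: measurable_completion)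
  have AE: "AE x in lebesgue. f x = g x"
    using fg by (rule AE_completion)
  have "integrable lebesgue g"
    using f by (subst integrable_cong_AE[OF _ _ AE, symmetric]) measurable
  then have "integrable lborel g"
    by (simp add: integrable_completion)
  moreover have "fourier f \<xi> = (\<integral>x. iexp (- (x \<bullet> \<xi>)) * g x \<partial>lborel)" for \<xi>
  proof -
    have "(\<lambda>x. iexp (- (x \<bullet> \<xi>))) \<in> borel_measurable borel"
      by measurable
    then have m: "(\<lambda>x. iexp (- (x \<bullet> \<xi>))) \<in> borel_measurable lebesgue"
      by (intro measurable_completion) simp
    have "fourier f \<xi> = (\<integral>x. iexp (- (x \<bullet> \<xi>)) * f x \<partial>lebesgue)"
      by (simp add: fourier_def)
    also have "\<dots> = (\<integral>x. iexp (- (x \<bullet> \<xi>)) * g x \<partial>lebesgue)"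
      using AE by (intro integral_cong_AE borel_measurable_times m) auto
    also have "\<dots> = (\<integral>x. iexp (- (x \<bullet> \<xi>)) * g x \<partial>lborel)"
      by (rule integral_completion) measurable
    finally show ?thesis .
  qed
  ultimately show thesis
    using that fg by blast
qed

lemma borel_measurable_fourier:
  fixes f :: "real ^ 'n \<Rightarrow> complex"
  assumes "integrable lebesgue f"
  shows "fourier f \<in> borel_measurable borel"
  using assms by (rule fourier_eq_lborel) (simp add: borel_measurable_Fourier_integral)

lemma norm_fourier_le:
  fixes f :: "real ^ 'n \<Rightarrow> complex"
  shows "norm (fourier f \<xi>) \<le> (\<integral>x. norm (f x) \<partial>lebesgue)"
  using integral_norm_bound[of lebesgue "\<lambda>x. exp (- \<i> * complex_of_real (x \<bullet> \<xi>)) * f x"]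
  by (simp add: fourier_def norm_mult)

text \<open>Needed for large |\<xi>|: the symbol multiplying \<open>fourier u0\<close> in
  \<open>u_hat\<close> tends to exp (- t) there, so integrability must come from the data.\<close>

lemma integrable_norm_fourier_sq:
  fixes f :: "real ^ 'n \<Rightarrow> complex"
  assumes f: "integrable lebesgue f" "f \<in> L2"
  shows "integrable lborel (\<lambda>\<xi>. (norm (fourier f \<xi>))\<^sup>2)"
proof -
  obtain g where g: "integrable lborel g" and fg: "AE x in lborel. f x = g x"
    and eq: "fourier f = (\<lambda>\<xi>. \<integral>x. iexp (- (x \<bullet> \<xi>)) * g x \<partial>lborel)"
    using f(1) by (rule fourier_eq_lborel)
  note [measurable] = borel_measurable_fourier[OF f(1)]
  have "(\<integral>\<^sup>+x. ennreal ((norm (g x))\<^sup>2) \<partial>lborel) = (\<integral>\<^sup>+x. ennreal ((norm (f x))\<^sup>2) \<partial>lborel)"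
    using fg by (intro nn_integral_cong_AE) auto
  also have "\<dots> = (\<integral>\<^sup>+x. ennreal ((norm (f x))\<^sup>2) \<partial>lebesgue)"
    by (rule nn_integral_completion[symmetric])
  also have "\<dots> = ennreal (\<integral>x. (norm (f x))\<^sup>2 \<partial>lebesgue)"
    using f(2) by (intro nn_integral_eq_integral) (auto simp: L2_def)
  finally have "(\<integral>\<^sup>+\<xi>. ennreal ((norm (fourier f \<xi>))\<^sup>2) \<partial>lborel)
      \<le> ennreal ((2 * pi) ^ DIM(real ^ 'n) * (\<integral>x. (norm (f x))\<^sup>2 \<partial>lebesgue))"
    using nn_integral_norm_Fourier_integral_sq_le[OF g] unfolding eq by (simp only: ennreal_mult'' integral_nonneg_AE AE_I2 zero_le_power2)
  then have "(\<integral>\<^sup>+\<xi>. ennreal ((norm (fourier f \<xi>))\<^sup>2) \<partial>lborel) < \<infinity>"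
    by (rule le_less_trans) simp
  then show ?thesis
    by (intro integrableI_bounded) simp_all
qed

section \<open>Multi-indices and Taylor terms of the Fourier transform\<close>

text \<open>Division by d! turns the binomial coefficient into a product, the form in which an
  induction over coordinates closes and in which the 1 / \<alpha>! of \<open>moment\<close>
  appears.\<close>

lemma binomial_div_fact:
  fixes a b :: "'a::field_char_0"
  shows "(a + b) ^ d / fact d = (\<Sum>j\<le>d. (a ^ j / fact j) * (b ^ (d - j) / fact (d - j)))"
proof -
  have "of_nat (d choose j) * a ^ j * b ^ (d - j) / fact d = (a ^ j / fact j) * (b ^ (d - j) / fact (d - j))"
    if "j \<le> d" for j
    using that by (simp add: binomial_fact)
  then show ?thesis
    unfolding binomial_ring sum_divide_distrib by (intro sum.cong) auto
qed

text \<open>Multi-indices on \<open>A\<close> are total functions vanishing outside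
  \<open>A\<close>, so each is counted once. Inserting x splits \<alpha> into its value at x and the
  function with that value reset to 0, and \<open>binomial_div_fact\<close> handles the
  split.\<close>

lemma multinomial_div_fact_on:
  fixes a :: "'i \<Rightarrow> 'a::field_char_0"
  assumes "finite A"
  shows "(\<Sum>i\<in>A. a i) ^ d / fact d =
    (\<Sum>\<alpha> | (\<forall>i. i \<notin> A \<longrightarrow> \<alpha> i = 0) \<and> sum \<alpha> A = d. \<Prod>i\<in>A. a i ^ \<alpha> i / fact (\<alpha> i))"
  using assms
proof (induction A arbitrary: d)
  case empty
  have "{\<alpha> :: 'i \<Rightarrow> nat. (\<forall>i. \<alpha> i = 0) \<and> 0 = d} = (if d = 0 then {\<lambda>_. 0} else {})"
    by auto
  then show ?case
    by simp
next
  case (insert x A)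
  let ?S = "\<lambda>A d. {\<alpha> :: 'i \<Rightarrow> nat. (\<forall>i. i \<notin> A \<longrightarrow> \<alpha> i = 0) \<and> sum \<alpha> A = d}"
  let ?m = "\<lambda>\<alpha> i. a i ^ \<alpha> i / fact (\<alpha> i)"
  have fin: "finite (?S A d)" for d
  proof (rule finite_subset)
    show "?S A d \<subseteq> {f. f ` A \<subseteq> {..d} \<and> f ` (- A) \<subseteq> {0}}"
      using member_le_sum[OF _ _ insert(1)] by fastforce
    show "finite {f :: 'i \<Rightarrow> nat. f ` A \<subseteq> {..d} \<and> f ` (- A) \<subseteq> {0}}"
    proof (rule finite_subset[OF _ finite_set_of_finite_funs[OF insert(1), of "{..d}" 0]])
    qed auto
  qed
  have "(\<Sum>i\<in>insert x A. a i) ^ d / fact d =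
      (\<Sum>j\<le>d. \<Sum>\<beta>\<in>?S A (d - j). (a x ^ j / fact j) * (\<Prod>i\<in>A. ?m \<beta> i))"
    using insert(1,2) by (simp add: binomial_div_fact insert.IH sum_distrib_left)
  also have "\<dots> = (\<Sum>(j, \<beta>)\<in>(SIGMA j:{..d}. ?S A (d - j)). (a x ^ j / fact j) * (\<Prod>i\<in>A. ?m \<beta> i))"
    using fin by (intro sum.Sigma) auto
  also have "\<dots> = (\<Sum>\<alpha>\<in>?S (insert x A) d. \<Prod>i\<in>insert x A. ?m \<alpha> i)"
  proof (rule sum.reindex_bij_witness[where i="\<lambda>\<alpha>. (\<alpha> x, \<alpha>(x := 0))" and j="\<lambda>(j, \<beta>). \<beta>(x := j)"])
    fix p assume "p \<in> (SIGMA j:{..d}. ?S A (d - j))"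
    then obtain j \<beta> where p: "p = (j, \<beta>)" "j \<le> d" "\<beta> \<in> ?S A (d - j)"
      by auto
    have s: "sum (\<beta>(x := j)) A = sum \<beta> A"
      using insert(2) by (intro sum.cong) auto
    have pr: "(\<Prod>i\<in>A. ?m (\<beta>(x := j)) i) = (\<Prod>i\<in>A. ?m \<beta> i)"
      using insert(2) by (intro prod.cong) auto
    show "((case p of (j, \<beta>) \<Rightarrow> \<beta>(x := j)) x, (case p of (j, \<beta>) \<Rightarrow> \<beta>(x := j))(x := 0)) = p"
      using p insert(2) by auto
    show "(case p of (j, \<beta>) \<Rightarrow> \<beta>(x := j)) \<in> ?S (insert x A) d"
      using p insert(1,2) s by simp
    show "(\<Prod>i\<in>insert x A. ?m (case p of (j, \<beta>) \<Rightarrow> \<beta>(x := j)) i) = (case p of (j, \<beta>) \<Rightarrow> (a x ^ j / fact j) * (\<Prod>i\<in>A. ?m \<beta> i))"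
      using p insert(1,2) pr by simp
  next
    fix \<alpha> assume \<alpha>: "\<alpha> \<in> ?S (insert x A) d"
    have s: "sum (\<alpha>(x := 0)) A = sum \<alpha> A"
      using insert(2) by (intro sum.cong) auto
    show "(case (\<alpha> x, \<alpha>(x := 0)) of (j, \<beta>) \<Rightarrow> \<beta>(x := j)) = \<alpha>"
      by auto
    show "(\<alpha> x, \<alpha>(x := 0)) \<in> (SIGMA j:{..d}. ?S A (d - j))"
      using \<alpha> insert(1,2) s by auto
  qed
  finally show ?case .
qed

lemma inner_power_div_fact:
  fixes x \<xi> :: "real ^ 'n"
  shows "(x \<bullet> \<xi>) ^ d / fact d = (\<Sum>\<alpha> | mi_abs \<alpha> = d. mi_power x \<alpha> * mi_power \<xi> \<alpha> / mi_fact \<alpha>)"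
proof -
  have "(x \<bullet> \<xi>) ^ d / fact d = (\<Sum>i\<in>UNIV. x $ i * \<xi> $ i) ^ d / fact d"
    by (simp add: inner_vec_def)
  also have "\<dots> = (\<Sum>\<alpha> | mi_abs \<alpha> = d. \<Prod>i\<in>UNIV. (x $ i * \<xi> $ i) ^ \<alpha> i / fact (\<alpha> i))"
    by (subst multinomial_div_fact_on) (simp_all add: mi_abs_def)
  also have "\<dots> = (\<Sum>\<alpha> | mi_abs \<alpha> = d. mi_power x \<alpha> * mi_power \<xi> \<alpha> / mi_fact \<alpha>)"
    by (simp add: mi_power_def mi_fact_def prod_dividef power_mult_distrib prod.distrib)
  finally show ?thesis .
qed

lemma abs_mi_power_le: "\<bar>mi_power (x :: real ^ 'n) \<alpha>\<bar> \<le> norm x ^ mi_abs \<alpha>"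
proof -
  have "\<bar>mi_power x \<alpha>\<bar> = (\<Prod>i\<in>UNIV. \<bar>x $ i\<bar> ^ \<alpha> i)"
    by (simp add: mi_power_def abs_prod power_abs)
  also have "\<dots> \<le> (\<Prod>i\<in>UNIV. norm x ^ \<alpha> i)"
    by (intro prod_mono conjI power_mono component_le_norm_cart) auto
  also have "\<dots> = norm x ^ mi_abs \<alpha>"
    by (simp add: mi_abs_def power_sum)
  finally show ?thesis .
qed

lemma continuous_on_mi_power: "continuous_on S (\<lambda>x :: real ^ 'n. mi_power x \<alpha>)"
  unfolding mi_power_def by (intro continuous_intros)

lemma mi_power_i_times: "mi_power (i_times \<xi>) \<alpha> = \<i> ^ mi_abs \<alpha> * complex_of_real (mi_power \<xi> \<alpha>)"
  unfolding mi_power_def i_times_def mi_abs_def power_sum of_real_prod prod.distrib[symmetric]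
  by (simp add: power_mult_distrib)

lemma mi_power_scaleR: "mi_power (c *\<^sub>R x) \<alpha> = c ^ mi_abs \<alpha> * mi_power (x :: real ^ 'n) \<alpha>"
  unfolding mi_power_def mi_abs_def power_sum prod.distrib[symmetric]
  by (simp add: power_mult_distrib)

text \<open>For \<open>v\<close> with finite moments up to order d, this is the part of degree d in
  the Taylor expansion of \<open>fourier v\<close> at the origin.\<close>

definition taylor_term :: "(real ^ 'n \<Rightarrow> complex) \<Rightarrow> nat \<Rightarrow> real ^ 'n \<Rightarrow> complex" where
  "taylor_term v d \<xi> = (\<Sum>\<alpha> | mi_abs \<alpha> = d. moment \<alpha> v * mi_power (i_times \<xi>) \<alpha>)"

lemma taylor_term_scaleR: "taylor_term v d (c *\<^sub>R \<xi>) = of_real (c ^ d) * taylor_term v d \<xi>"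
  unfolding taylor_term_def sum_distrib_left
  by (intro sum.cong refl) (simp add: mi_power_i_times mi_power_scaleR)

lemma borel_measurable_taylor_term: "taylor_term v d \<in> borel_measurable borel"
  unfolding taylor_term_def[abs_def] mi_power_i_times
  by (intro borel_measurable_continuous_onI continuous_intros continuous_on_mi_power)

lemma sum_mi_abs_le:
  "(\<Sum>\<alpha> | mi_abs \<alpha> \<le> m. moment \<alpha> v * mi_power (i_times \<xi>) \<alpha>) = (\<Sum>d\<le>m. taylor_term v d \<xi>)"
proof -
  have eq: "{\<alpha>. mi_abs \<alpha> \<le> m} = (\<Union>d\<in>{..m}. {\<alpha>. mi_abs \<alpha> = d})"
    by auto
  show ?thesis
    unfolding taylor_term_def eq by (rule sum.UNION_disjoint) (auto simp: finite_mi_abs_eq)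
qed

section \<open>Weighted integrability and Taylor remainders of the Fourier transform\<close>

lemma L1_weighted_integrable:
  "v \<in> L1_weighted \<gamma> \<Longrightarrow> integrable lebesgue v"
  by (simp add: L1_weighted_def)

lemma continuous_borel_measurable_lebesgue:
  fixes g :: "'a::euclidean_space \<Rightarrow> 'b::real_normed_vector"
  assumes "continuous_on UNIV g"
  shows "g \<in> borel_measurable lebesgue"
  using assms by (intro measurable_completion) (simp add: borel_measurable_continuous_onI)

text \<open>The factor \<open>h\<close> shares only its modulus with \<open>v\<close>, so that the
  lemma serves both the complex integrands with \<open>v\<close> and the real ones with
  \<open>norm (v x)\<close>.\<close>

lemma L1_weighted_integrable_mult:
  fixes v :: "real ^ 'n \<Rightarrow> complex" and g :: "real ^ 'n \<Rightarrow> 'b::{real_normed_field, banach, second_countable_topology}"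
    and h :: "real ^ 'n \<Rightarrow> 'b"
  assumes v: "v \<in> L1_weighted (real k)" and g: "continuous_on UNIV g"
    and le: "\<And>x. norm (g x) \<le> C * (1 + norm x) ^ k" and h: "\<And>x. norm (h x) = norm (v x)" "h \<in> borel_measurable lebesgue"
  shows "integrable lebesgue (\<lambda>x. g x * h x)"
proof (rule Bochner_Integration.integrable_bound)
  note [measurable] = continuous_borel_measurable_lebesgue[OF g] h(2)
  show "integrable lebesgue (\<lambda>x. C * ((1 + norm x) powr real k * cmod (v x)))"
    using v by (simp add: L1_weighted_def)
  show "(\<lambda>x. g x * h x) \<in> borel_measurable lebesgue"
    by measurable
  show "AE x in lebesgue. norm (g x * h x) \<le> norm (C * ((1 + norm x) powr real k * cmod (v x)))"
  proof (rule AE_I2)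
    fix x :: "real ^ 'n"
    have pos: "0 < 1 + norm x"
      by (simp add: add_pos_nonneg)
    have "norm (g x * h x) \<le> C * (1 + norm x) ^ k * cmod (v x)"
      unfolding norm_mult h(1) by (intro mult_right_mono le) simp
    also have "\<dots> \<le> norm (C * ((1 + norm x) powr real k * cmod (v x)))"
      using pos by (simp add: powr_realpow mult.assoc)
    finally show "norm (g x * h x) \<le> norm (C * ((1 + norm x) powr real k * cmod (v x)))" .
  qed
qed

lemma power_le_weight:
  assumes "j \<le> k"
  shows "norm (x :: 'a::real_normed_vector) ^ j \<le> (1 + norm x) ^ k"
proof -
  have "norm x ^ j \<le> (1 + norm x) ^ j"
    by (intro power_mono) auto
  also have "\<dots> \<le> (1 + norm x) ^ k"
    using assms by (intro power_increasing) auto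
  finally show ?thesis .
qed

context
  fixes v :: "real ^ 'n \<Rightarrow> complex" and k :: nat
  assumes v: "v \<in> L1_weighted (real k)"
begin

lemma borel_measurable_L1_weighted [measurable]: "v \<in> borel_measurable lebesgue"
  using L1_weighted_integrable[OF v] by (rule borel_measurable_integrable)

lemma integrable_power_mult_norm:
  assumes "j \<le> k"
  shows "integrable lebesgue (\<lambda>x. norm x ^ j * norm (v x))"
  using power_le_weight[OF assms]
  by (intro L1_weighted_integrable_mult[OF v, where C=1] continuous_intros) auto

lemma integrable_power_inner_mult:
  assumes "j \<le> k"
  shows "integrable lebesgue (\<lambda>x. (\<i> * complex_of_real (- (x \<bullet> \<xi>))) ^ j / fact j * v x)"
proof (rule L1_weighted_integrable_mult[OF v, where C="norm \<xi> ^ j"])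
  show "continuous_on UNIV (\<lambda>x. (\<i> * complex_of_real (- (x \<bullet> \<xi>))) ^ j / fact j)"
    by (intro continuous_intros) auto
  show "cmod ((\<i> * complex_of_real (- (x \<bullet> \<xi>))) ^ j / fact j) \<le> norm \<xi> ^ j * (1 + norm x) ^ k" for x
  proof -
    have "cmod ((\<i> * complex_of_real (- (x \<bullet> \<xi>))) ^ j / fact j) = \<bar>x \<bullet> \<xi>\<bar> ^ j / fact j"
      by (simp add: norm_divide norm_power norm_mult)
    also have "\<dots> \<le> \<bar>x \<bullet> \<xi>\<bar> ^ j"
      by (simp add: divide_le_eq mult_le_cancel_left1 fact_ge_1)
    also have "\<dots> \<le> (norm x * norm \<xi>) ^ j"
      by (intro power_mono Cauchy_Schwarz_ineq2) simp
    also have "\<dots> \<le> norm \<xi> ^ j * (1 + norm x) ^ k"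
      using power_le_weight[OF assms, of x]
      by (simp add: power_mult_distrib mult.commute mult_left_mono)
    finally show ?thesis .
  qed
qed simp_all

text \<open>The multinomial formula expands the power of the inner product into monomials; the
  factor (-i)^j splits into the sign inside \<open>moment\<close> and the powers of i from
  \<open>i_times\<close>.\<close>

lemma taylor_term_eq_integral:
  assumes "j \<le> k"
  shows "taylor_term v j \<xi> = (\<integral>x. (\<i> * complex_of_real (- (x \<bullet> \<xi>))) ^ j / fact j * v x \<partial>lebesgue)"
proof -
  let ?c = "\<lambda>\<alpha>. (- \<i>) ^ j * complex_of_real (mi_power \<xi> \<alpha>) / of_nat (mi_fact \<alpha>)"
  have int: "integrable lebesgue (\<lambda>x. complex_of_real (mi_power x \<alpha>) * v x)" if "mi_abs \<alpha> = j" for \<alpha>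
    using abs_mi_power_le[of _ \<alpha>] power_le_weight[OF assms] that
    by (intro L1_weighted_integrable_mult[OF v, where C=1] continuous_intros continuous_on_mi_power)
      (auto intro: order_trans)
  have expand: "(\<i> * complex_of_real (- (x \<bullet> \<xi>))) ^ j / fact j =
      (\<Sum>\<alpha> | mi_abs \<alpha> = j. ?c \<alpha> * complex_of_real (mi_power x \<alpha>))" for x
  proof -
    have "(\<i> * complex_of_real (- (x \<bullet> \<xi>))) ^ j / fact j = (- \<i>) ^ j * complex_of_real ((x \<bullet> \<xi>) ^ j / fact j)"
      by (simp add: power_mult_distrib[symmetric])
    also have "\<dots> = (\<Sum>\<alpha> | mi_abs \<alpha> = j. ?c \<alpha> * complex_of_real (mi_power x \<alpha>))"
      unfolding inner_power_div_fact by (simp add: sum_distrib_left mult_ac)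
    finally show ?thesis .
  qed
  have "(\<integral>x. (\<i> * complex_of_real (- (x \<bullet> \<xi>))) ^ j / fact j * v x \<partial>lebesgue) =
      (\<integral>x. (\<Sum>\<alpha> | mi_abs \<alpha> = j. ?c \<alpha> * (complex_of_real (mi_power x \<alpha>) * v x)) \<partial>lebesgue)"
    unfolding expand sum_distrib_right by (simp only: mult.assoc)
  also have "\<dots> = (\<Sum>\<alpha> | mi_abs \<alpha> = j. ?c \<alpha> * (\<integral>x. complex_of_real (mi_power x \<alpha>) * v x \<partial>lebesgue))"
    using int by (subst Bochner_Integration.integral_sum) auto
  also have "\<dots> = taylor_term v j \<xi>"
    unfolding taylor_term_def moment_def mi_power_i_times
  proof (intro sum.cong refl)
    fix \<alpha> :: "'n \<Rightarrow> nat" assume "\<alpha> \<in> {\<alpha>. mi_abs \<alpha> = j}"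
    moreover have "(- \<i>) ^ j = (- 1) ^ j * \<i> ^ j"
      by (simp add: power_mult_distrib[symmetric])
    ultimately show "?c \<alpha> * (\<integral>x. complex_of_real (mi_power x \<alpha>) * v x \<partial>lebesgue) =
        (- 1) ^ mi_abs \<alpha> / of_nat (mi_fact \<alpha>) * (\<integral>x. complex_of_real (mi_power x \<alpha>) * v x \<partial>lebesgue) *
        (\<i> ^ mi_abs \<alpha> * complex_of_real (mi_power \<xi> \<alpha>))"
      by (simp add: mult_ac)
  qed
  finally show ?thesis ..
qed

lemma norm_taylor_term_le:
  assumes "j \<le> k"
  shows "norm (taylor_term v j \<xi>) \<le> norm \<xi> ^ j * (\<integral>x. norm x ^ j * norm (v x) \<partial>lebesgue)"
proof -
  have "norm (taylor_term v j \<xi>) \<le> (\<integral>x. norm \<xi> ^ j * (norm x ^ j * norm (v x)) \<partial>lebesgue)"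
    unfolding taylor_term_eq_integral[OF assms]
  proof (rule Bochner_Integration.integral_norm_bound_integral)
    fix x :: "real ^ 'n"
    have "\<bar>x \<bullet> \<xi>\<bar> ^ j / fact j \<le> \<bar>x \<bullet> \<xi>\<bar> ^ j"
      by (simp add: divide_le_eq mult_le_cancel_left1 fact_ge_1)
    also have "\<dots> \<le> (norm x * norm \<xi>) ^ j"
      by (intro power_mono Cauchy_Schwarz_ineq2) simp
    finally have "\<bar>x \<bullet> \<xi>\<bar> ^ j / fact j * norm (v x) \<le> (norm x * norm \<xi>) ^ j * norm (v x)"
      by (rule mult_right_mono) simp
    then show "norm ((\<i> * complex_of_real (- (x \<bullet> \<xi>))) ^ j / fact j * v x) \<le> norm \<xi> ^ j * (norm x ^ j * norm (v x))"
      by (simp add: norm_divide norm_power norm_mult power_mult_distrib mult_ac)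
  qed (use integrable_power_inner_mult integrable_power_mult_norm assms in auto)
  then show ?thesis
    by simp
qed

lemma fourier_minus_taylor:
  assumes "j \<le> k"
  shows "integrable lebesgue (\<lambda>x. (iexp (- (x \<bullet> \<xi>)) - (\<Sum>d\<le>j. (\<i> * complex_of_real (- (x \<bullet> \<xi>))) ^ d / fact d)) * v x)" (is ?int)
    and "fourier v \<xi> - (\<Sum>d\<le>j. taylor_term v d \<xi>) =
      (\<integral>x. (iexp (- (x \<bullet> \<xi>)) - (\<Sum>d\<le>j. (\<i> * complex_of_real (- (x \<bullet> \<xi>))) ^ d / fact d)) * v x \<partial>lebesgue)" (is ?eq)
proof -
  have e: "integrable lebesgue (\<lambda>x. iexp (- (x \<bullet> \<xi>)) * v x)"
    by (intro L1_weighted_integrable_mult[OF v, where C=1] continuous_intros) (auto simp: one_le_power)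
  have p: "integrable lebesgue (\<lambda>x. (\<i> * complex_of_real (- (x \<bullet> \<xi>))) ^ d / fact d * v x)" if "d \<le> j" for d
    using that assms by (intro integrable_power_inner_mult) simp
  show ?int
    unfolding left_diff_distrib sum_distrib_right using e p by (intro Bochner_Integration.integrable_diff Bochner_Integration.integrable_sum) auto
  have "(\<Sum>d\<le>j. taylor_term v d \<xi>) = (\<Sum>d\<le>j. \<integral>x. (\<i> * complex_of_real (- (x \<bullet> \<xi>))) ^ d / fact d * v x \<partial>lebesgue)"
    using assms by (intro sum.cong taylor_term_eq_integral) auto
  also have "\<dots> = (\<integral>x. (\<Sum>d\<le>j. (\<i> * complex_of_real (- (x \<bullet> \<xi>))) ^ d / fact d * v x) \<partial>lebesgue)"
    using p by (intro Bochner_Integration.integral_sum[symmetric]) auto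
  finally have "fourier v \<xi> - (\<Sum>d\<le>j. taylor_term v d \<xi>) = (\<integral>x. iexp (- (x \<bullet> \<xi>)) * v x \<partial>lebesgue) -
      (\<integral>x. (\<Sum>d\<le>j. (\<i> * complex_of_real (- (x \<bullet> \<xi>))) ^ d / fact d * v x) \<partial>lebesgue)"
    by (simp add: fourier_def)
  also have "\<dots> = (\<integral>x. iexp (- (x \<bullet> \<xi>)) * v x - (\<Sum>d\<le>j. (\<i> * complex_of_real (- (x \<bullet> \<xi>))) ^ d / fact d * v x) \<partial>lebesgue)"
    using e p by (intro Bochner_Integration.integral_diff[symmetric] Bochner_Integration.integrable_sum) auto
  finally show ?eq
    unfolding left_diff_distrib sum_distrib_right .
qed

text \<open>Below order k one more moment is finite, so the remainder has the full next order. At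
  order k this extra moment is missing, which forces the weaker \<epsilon>-form further
  down.\<close>

lemma norm_fourier_minus_taylor_le:
  assumes "j < k"
  shows "norm (fourier v \<xi> - (\<Sum>d\<le>j. taylor_term v d \<xi>)) \<le> norm \<xi> ^ Suc j * (\<integral>x. norm x ^ Suc j * norm (v x) \<partial>lebesgue)"
proof -
  have "norm (fourier v \<xi> - (\<Sum>d\<le>j. taylor_term v d \<xi>)) \<le> (\<integral>x. norm \<xi> ^ Suc j * (norm x ^ Suc j * norm (v x)) \<partial>lebesgue)"
    unfolding fourier_minus_taylor(2)[OF less_imp_le[OF assms]]
  proof (rule Bochner_Integration.integral_norm_bound_integral)
    fix x :: "real ^ 'n"
    have "norm (iexp (- (x \<bullet> \<xi>)) - (\<Sum>d\<le>j. (\<i> * complex_of_real (- (x \<bullet> \<xi>))) ^ d / fact d)) \<le> \<bar>- (x \<bullet> \<xi>)\<bar> ^ Suc j / fact (Suc j)"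
      by (rule iexp_approx1)
    also have "\<dots> \<le> \<bar>x \<bullet> \<xi>\<bar> ^ Suc j"
      unfolding abs_minus_cancel by (simp add: divide_le_eq mult_le_cancel_left1 fact_ge_1 del: fact_Suc power_Suc)
    also have "\<dots> \<le> (norm x * norm \<xi>) ^ Suc j"
      by (intro power_mono Cauchy_Schwarz_ineq2) simp
    also have "\<dots> = norm \<xi> ^ Suc j * norm x ^ Suc j"
      unfolding power_mult_distrib by (rule mult.commute)
    finally show "norm ((iexp (- (x \<bullet> \<xi>)) - (\<Sum>d\<le>j. (\<i> * complex_of_real (- (x \<bullet> \<xi>))) ^ d / fact d)) * v x)
        \<le> norm \<xi> ^ Suc j * (norm x ^ Suc j * norm (v x))"
      unfolding norm_mult mult.assoc[symmetric] by (rule mult_right_mono) simp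
  next
    show "integrable lebesgue (\<lambda>x. norm \<xi> ^ Suc j * (norm x ^ Suc j * norm (v x)))"
      using integrable_power_mult_norm[of "Suc j"] assms by auto
  qed (use fourier_minus_taylor(1) assms in auto)
  then show ?thesis
    by simp
qed

text \<open>At a fixed x the indicator vanishes as soon as R reaches |x|, and the full moment
  integrand dominates. All smallness in the remainder of order k comes from here.\<close>

lemma tail_integral_tendsto:
  "(\<lambda>R. \<integral>x. indicator {x. real R < norm x} x * (norm x ^ k * norm (v x)) \<partial>lebesgue) \<longlonglongrightarrow> 0"
proof -
  have int: "integrable lebesgue (\<lambda>x. norm x ^ k * norm (v x))"
    by (rule integrable_power_mult_norm) simp
  have "{x :: real ^ 'n. real R < norm x} \<in> sets lebesgue" for R
    by (intro sets_completionI_sets) (simp add: borel_open open_Collect_less continuous_intros)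
  then have intR: "integrable lebesgue (\<lambda>x. indicator {x. real R < norm x} x * (norm x ^ k * norm (v x)))" for R
    using integrable_mult_indicator[OF _ int, of "{x. real R < norm x}"] by simp
  have "(\<lambda>R. \<integral>x. indicator {x. real R < norm x} x * (norm x ^ k * norm (v x)) \<partial>lebesgue) \<longlonglongrightarrow> (\<integral>x. 0 \<partial>(lebesgue :: (real ^ 'n) measure))"
  proof (rule integral_dominated_convergence[OF _ _ int])
    show "AE x in lebesgue. (\<lambda>R. indicator {x. real R < norm x} x * (norm x ^ k * norm (v x))) \<longlonglongrightarrow> 0"
    proof (rule AE_I2)
      fix x :: "real ^ 'n"
      obtain N where "norm x \<le> real N"
        using real_arch_simple by blast
      then have "\<forall>\<^sub>F R in sequentially. indicator {x. real R < norm x} x * (norm x ^ k * norm (v x)) = 0"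
        unfolding eventually_sequentially by (intro exI[of _ N]) (auto simp: indicator_def)
      then show "(\<lambda>R. indicator {x. real R < norm x} x * (norm x ^ k * norm (v x))) \<longlonglongrightarrow> 0"
        by (rule tendsto_eventually)
    qed
    show "(\<lambda>x. indicator {x. real R < norm x} x * (norm x ^ k * norm (v x))) \<in> borel_measurable lebesgue" for R
      using intR by (rule borel_measurable_integrable)
  qed (auto simp: indicator_def)
  then show ?thesis
    by simp
qed

text \<open>Split the moment integral at \<open>|x| = R\<close>: the outer part is small by dominated convergence, and on
  the inner part one more power of \<open>|x|\<close> costs only the factor \<open>R\<close>.\<close>

lemma norm_fourier_minus_taylor_small:
  assumes "\<epsilon> > 0"
  obtains C where "C \<ge> 0"
    "\<And>\<xi>. norm (fourier v \<xi> - (\<Sum>d\<le>k. taylor_term v d \<xi>)) \<le> \<epsilon> * norm \<xi> ^ k + C * norm \<xi> ^ Suc k"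
proof -
  have int: "integrable lebesgue (\<lambda>x. norm x ^ k * norm (v x))"
    by (rule integrable_power_mult_norm) simp
  \<comment> \<open>Half of \<epsilon>, because \<open>iexp_approx2\<close> carries a factor
    2.\<close>
  obtain R :: nat where R: "(\<integral>x. indicator {x. real R < norm x} x * (norm x ^ k * norm (v x)) \<partial>lebesgue) < \<epsilon> / 2"
    using order_tendstoD(2)[OF tail_integral_tendsto, of "\<epsilon> / 2"] assms by (auto simp: eventually_sequentially)
  have [measurable]: "{x :: real ^ 'n. real R < norm x} \<in> sets lebesgue"
    by (intro sets_completionI_sets) (simp add: borel_open open_Collect_less continuous_intros)
  have intR: "integrable lebesgue (\<lambda>x. indicator {x. real R < norm x} x * (norm x ^ k * norm (v x)))"
    using integrable_mult_indicator[OF _ int, of "{x. real R < norm x}"] by simp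
  define M where "M = (\<integral>x. norm x ^ k * norm (v x) \<partial>lebesgue)"
  show thesis
  proof
    show "0 \<le> real R * M"
      by (simp add: M_def)
    fix \<xi>
    have "norm (fourier v \<xi> - (\<Sum>d\<le>k. taylor_term v d \<xi>)) \<le>
        (\<integral>x. 2 * norm \<xi> ^ k * (indicator {x. real R < norm x} x * (norm x ^ k * norm (v x))) +
          norm \<xi> ^ Suc k * R * (norm x ^ k * norm (v x)) \<partial>lebesgue)"
      unfolding fourier_minus_taylor(2)[OF order_refl]
    proof (rule Bochner_Integration.integral_norm_bound_integral)
      fix x :: "real ^ 'n"
      let ?e = "norm (iexp (- (x \<bullet> \<xi>)) - (\<Sum>d\<le>k. (\<i> * complex_of_real (- (x \<bullet> \<xi>))) ^ d / fact d))"
      have "?e \<le> 2 * norm \<xi> ^ k * (indicator {x. real R < norm x} x * norm x ^ k) + norm \<xi> ^ Suc k * R * norm x ^ k"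
      proof (cases "real R < norm x")
        case True
        \<comment> \<open>On the tail the cruder bound of order k is taken, since one order more
          would require a moment beyond k.\<close>
        have "?e \<le> 2 * \<bar>- (x \<bullet> \<xi>)\<bar> ^ k / fact k"
          by (rule iexp_approx2)
        also have "\<dots> \<le> 2 * \<bar>x \<bullet> \<xi>\<bar> ^ k"
          by (simp add: divide_le_eq mult_le_cancel_left1 fact_ge_1)
        also have "\<bar>x \<bullet> \<xi>\<bar> ^ k \<le> (norm x * norm \<xi>) ^ k"
          by (intro power_mono Cauchy_Schwarz_ineq2) simp
        finally have "?e \<le> 2 * norm \<xi> ^ k * norm x ^ k"
          by (simp add: power_mult_distrib mult_ac)
        also have "\<dots> \<le> 2 * norm \<xi> ^ k * norm x ^ k + norm \<xi> ^ Suc k * R * norm x ^ k"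
          by simp
        finally show ?thesis
          using True by simp
      next
        case False
        have "?e \<le> \<bar>- (x \<bullet> \<xi>)\<bar> ^ Suc k / fact (Suc k)"
          by (rule iexp_approx1)
        also have "\<dots> \<le> \<bar>x \<bullet> \<xi>\<bar> ^ Suc k"
          unfolding abs_minus_cancel by (simp add: divide_le_eq mult_le_cancel_left1 fact_ge_1 del: fact_Suc power_Suc)
        also have "\<dots> \<le> (norm x * norm \<xi>) ^ Suc k"
          by (intro power_mono Cauchy_Schwarz_ineq2) simp
        also have "\<dots> = norm \<xi> ^ Suc k * norm x ^ k * norm x"
          by (simp add: power_mult_distrib mult_ac)
        also have "\<dots> \<le> norm \<xi> ^ Suc k * norm x ^ k * R"
          using False by (intro mult_left_mono) auto
        finally show ?thesis
          using False by (simp add: mult_ac)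
      qed
      from mult_right_mono[OF this norm_ge_zero[of "v x"]]
      show "norm ((iexp (- (x \<bullet> \<xi>)) - (\<Sum>d\<le>k. (\<i> * complex_of_real (- (x \<bullet> \<xi>))) ^ d / fact d)) * v x)
          \<le> 2 * norm \<xi> ^ k * (indicator {x. real R < norm x} x * (norm x ^ k * norm (v x))) +
            norm \<xi> ^ Suc k * R * (norm x ^ k * norm (v x))"
        unfolding norm_mult distrib_right by (simp only: mult.assoc)
    qed (use fourier_minus_taylor(1) int intR in auto)
    also have "\<dots> = norm \<xi> ^ k * (2 * (\<integral>x. indicator {x. real R < norm x} x * (norm x ^ k * norm (v x)) \<partial>lebesgue))
        + norm \<xi> ^ Suc k * R * M"
      using int intR unfolding M_def by (subst Bochner_Integration.integral_add) auto
    also have "\<dots> \<le> norm \<xi> ^ k * \<epsilon> + norm \<xi> ^ Suc k * R * M"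
      using R by (intro add_mono mult_left_mono) auto
    finally show "norm (fourier v \<xi> - (\<Sum>d\<le>k. taylor_term v d \<xi>)) \<le> \<epsilon> * norm \<xi> ^ k + real R * M * norm \<xi> ^ Suc k"
      by (simp add: mult_ac)
  qed
qed

end

section \<open>The profile functions\<close>

lemma sum_atMost_rev: "(\<Sum>j=0..p. f j) = (\<Sum>m\<le>p. f (p - m :: nat))"
  by (rule sum.reindex_bij_witness[where i="\<lambda>m. p - m" and j="\<lambda>j. p - j"]) auto

text \<open>Counting by m, the exponent of |\<xi>|^2, instead of by j merges the even and odd
  definitions. The right-hand side is the part of degree k in the product of the Taylor series and
  the geometric series.\<close>

lemma B_profile_eq:
  "B_profile k v \<xi> = (\<Sum>m\<le>k div 2. of_real (norm \<xi> ^ (2 * m)) * taylor_term v (k - 2 * m) \<xi>)"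
proof (cases "even k")
  case True
  then obtain p where k: "k = 2 * p" ..
  show ?thesis
    unfolding B_profile_def taylor_term_def[symmetric] sum_atMost_rev
    by (simp add: k diff_mult_distrib2[symmetric])
next
  case False
  then obtain p where k: "k = 2 * p + 1"
    by (rule oddE)
  have "Suc (2 * (p - m)) = Suc (2 * p) - 2 * m" if "m \<le> p" for m
    using that by simp
  moreover have "2 * p - 2 * (p - m) = 2 * m" if "m \<le> p" for m
    using that by simp
  ultimately show ?thesis
    unfolding B_profile_def taylor_term_def[symmetric] sum_atMost_rev
    by (simp add: k)
qed

lemma A_profile_pred_eq:
  "A_profile (int k - 1) v \<xi> =
    (\<Sum>m\<le>k div 2. of_real (norm \<xi> ^ (2 * m)) * (\<Sum>d<k - 2 * m. taylor_term v d \<xi>))"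
proof (cases "even k")
  case True
  then obtain p where k: "k = 2 * p" ..
  show ?thesis
  proof (cases p)
    \<comment> \<open>The convention that the profile of index -1 is zero agrees with the empty
      inner sum on the right.\<close>
    case 0
    then show ?thesis
      by (simp add: k A_profile_def)
  next
    case (Suc q)
    have k': "int k - 1 = int (Suc (2 * q))" and kdiv: "k div 2 = Suc q"
      by (simp_all add: k Suc)
    have "A_profile (int k - 1) v \<xi> =
        (\<Sum>m\<le>q. of_real (norm \<xi> ^ (2 * q - 2 * (q - m))) * (\<Sum>d\<le>2 * (q - m) + 1. taylor_term v d \<xi>))"
      unfolding A_profile_def sum_mi_abs_le k' nat_int sum_atMost_rev by simp
    also have "\<dots> = (\<Sum>m\<le>q. of_real (norm \<xi> ^ (2 * m)) * (\<Sum>d<k - 2 * m. taylor_term v d \<xi>))"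
    proof (intro sum.cong refl)
      fix m assume "m \<in> {..q}"
      then have "{..2 * (q - m) + 1} = {..<k - 2 * m}" and "2 * q - 2 * (q - m) = 2 * m"
        by (auto simp: k Suc)
      then show "of_real (norm \<xi> ^ (2 * q - 2 * (q - m))) * (\<Sum>d\<le>2 * (q - m) + 1. taylor_term v d \<xi>) =
          of_real (norm \<xi> ^ (2 * m)) * (\<Sum>d<k - 2 * m. taylor_term v d \<xi>)"
        by (simp only:)
    qed
    \<comment> \<open>For even k the range grows by one index, m = k div 2, whose inner sum is
      empty.\<close>
    also have "\<dots> = (\<Sum>m\<le>k div 2. of_real (norm \<xi> ^ (2 * m)) * (\<Sum>d<k - 2 * m. taylor_term v d \<xi>))"
      unfolding kdiv sum.atMost_Suc by (simp add: k Suc)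
    finally show ?thesis .
  qed
next
  case False
  then obtain p where k: "k = 2 * p + 1"
    by (rule oddE)
  have "{..2 * (p - m)} = {..<k - 2 * m}" and "2 * p - 2 * (p - m) = 2 * m" if "m \<le> p" for m
    using that by (auto simp: k)
  then show ?thesis
    unfolding A_profile_def sum_mi_abs_le
    by (simp add: k sum_atMost_rev nat_mult_distrib)
qed

text \<open>\<open>B_profile\<close> contributes exactly the top degree d = k - 2 m that is missing
  from each inner sum of \<open>A_profile\<close>.\<close>

lemma A_profile_add_B_profile:
  "A_profile (int k - 1) v \<xi> + B_profile k v \<xi> =
    (\<Sum>m\<le>k div 2. of_real (norm \<xi> ^ (2 * m)) * (\<Sum>d\<le>k - 2 * m. taylor_term v d \<xi>))"
  unfolding A_profile_pred_eq B_profile_eq sum.distrib[symmetric] distrib_left[symmetric]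
  by (simp add: lessThan_Suc_atMost[symmetric])

lemma borel_measurable_A_profile_pred: "A_profile (int k - 1) v \<in> borel_measurable borel"
proof -
  note [measurable] = borel_measurable_taylor_term
  show ?thesis
    unfolding A_profile_pred_eq[abs_def] by measurable
qed

lemma borel_measurable_B_profile: "B_profile k v \<in> borel_measurable borel"
proof -
  note [measurable] = borel_measurable_taylor_term
  show ?thesis
    unfolding B_profile_eq[abs_def] by measurable
qed

lemma B_profile_scaleR:
  assumes "c \<ge> 0"
  shows "B_profile k v (c *\<^sub>R \<xi>) = of_real (c ^ k) * B_profile k v \<xi>"
  unfolding B_profile_eq sum_distrib_left
proof (intro sum.cong refl)
  fix m assume "m \<in> {..k div 2}"
  then have "c ^ k = c ^ (2 * m) * c ^ (k - 2 * m)"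
    by (simp add: power_add[symmetric])
  then show "of_real (norm (c *\<^sub>R \<xi>) ^ (2 * m)) * taylor_term v (k - 2 * m) (c *\<^sub>R \<xi>) =
      of_real (c ^ k) * (of_real (norm \<xi> ^ (2 * m)) * taylor_term v (k - 2 * m) \<xi>)"
    using assms by (simp add: taylor_term_scaleR power_mult_distrib)
qed

lemma norm_B_profile_le:
  assumes v: "v \<in> L1_weighted (real k)"
  obtains C where "C \<ge> 0" "\<And>\<xi>. norm (B_profile k v \<xi>) \<le> C * norm \<xi> ^ k"
proof
  let ?K = "\<lambda>j. \<integral>x. norm x ^ j * norm (v x) \<partial>lebesgue"
  show "0 \<le> (\<Sum>m\<le>k div 2. ?K (k - 2 * m))"
    by (intro sum_nonneg) simp
  fix \<xi>
  show "norm (B_profile k v \<xi>) \<le> (\<Sum>m\<le>k div 2. ?K (k - 2 * m)) * norm \<xi> ^ k"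
    unfolding B_profile_eq sum_distrib_right
  proof (rule sum_norm_le)
    fix m assume "m \<in> {..k div 2}"
    then have k: "norm \<xi> ^ k = norm \<xi> ^ (2 * m) * norm \<xi> ^ (k - 2 * m)"
      by (simp add: power_add[symmetric])
    have "norm (taylor_term v (k - 2 * m) \<xi>) \<le> norm \<xi> ^ (k - 2 * m) * ?K (k - 2 * m)"
      by (rule norm_taylor_term_le[OF v]) simp
    from mult_left_mono[OF this, of "norm \<xi> ^ (2 * m)"]
    show "norm (of_real (norm \<xi> ^ (2 * m)) * taylor_term v (k - 2 * m) \<xi>) \<le> ?K (k - 2 * m) * norm \<xi> ^ k"
      unfolding k norm_mult norm_of_real by (simp add: mult_ac)
  qed
qed

text \<open>Every term has degree at most k, and 1 \<le> 2 |\<xi>| allows raising each degree to k +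
  1 at the cost of powers of 2. The region away from the origin then fits into the same
  |\<xi>|^(k+1) term as the remainder near it.\<close>

lemma norm_A_add_B_profile_le:
  assumes v: "v \<in> L1_weighted (real k)"
  obtains C where "C \<ge> 0"
    "\<And>\<xi>. 1 / 2 \<le> norm \<xi> \<Longrightarrow> norm (A_profile (int k - 1) v \<xi> + B_profile k v \<xi>) \<le> C * norm \<xi> ^ Suc k"
proof
  let ?K = "\<lambda>j. \<integral>x. norm x ^ j * norm (v x) \<partial>lebesgue"
  let ?C = "\<lambda>m d. 2 ^ (Suc k - (2 * m + d)) * ?K d"
  show "0 \<le> (\<Sum>m\<le>k div 2. \<Sum>d\<le>k - 2 * m. ?C m d)"
    by (intro sum_nonneg mult_nonneg_nonneg) simp_all
  fix \<xi> :: "real ^ 'a" assume \<xi>: "1 / 2 \<le> norm \<xi>"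
  show "norm (A_profile (int k - 1) v \<xi> + B_profile k v \<xi>) \<le> (\<Sum>m\<le>k div 2. \<Sum>d\<le>k - 2 * m. ?C m d) * norm \<xi> ^ Suc k"
    unfolding A_profile_add_B_profile sum_distrib_right sum_distrib_left
  proof (intro sum_norm_le)
    fix m d assume "m \<in> {..k div 2}" "d \<in> {..k - 2 * m}"
    then have d: "d \<le> k" and md: "2 * m + d \<le> Suc k"
      by auto
    have "1 \<le> (2 * norm \<xi>) ^ (Suc k - (2 * m + d))"
      using \<xi> by (intro one_le_power) simp
    then have "norm \<xi> ^ (2 * m + d) * 1 \<le> norm \<xi> ^ (2 * m + d) * (2 * norm \<xi>) ^ (Suc k - (2 * m + d))"
      by (rule mult_left_mono) simp
    also have "\<dots> = 2 ^ (Suc k - (2 * m + d)) * (norm \<xi> ^ (2 * m + d) * norm \<xi> ^ (Suc k - (2 * m + d)))"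
      by (simp only: power_mult_distrib mult_ac)
    also have "\<dots> = 2 ^ (Suc k - (2 * m + d)) * norm \<xi> ^ Suc k"
      unfolding power_add[symmetric] using md by simp
    finally have le: "norm \<xi> ^ (2 * m + d) \<le> 2 ^ (Suc k - (2 * m + d)) * norm \<xi> ^ Suc k"
      by simp
    have "norm (of_real (norm \<xi> ^ (2 * m)) * taylor_term v d \<xi>) \<le> norm \<xi> ^ (2 * m) * (norm \<xi> ^ d * ?K d)"
      unfolding norm_mult norm_of_real using norm_taylor_term_le[OF v d] by (intro mult_mono) auto
    also have "\<dots> = norm \<xi> ^ (2 * m + d) * ?K d"
      by (simp add: power_add mult_ac)
    also have "\<dots> \<le> (2 ^ (Suc k - (2 * m + d)) * norm \<xi> ^ Suc k) * ?K d"
      by (intro mult_right_mono le) simp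
    finally show "norm (of_real (norm \<xi> ^ (2 * m)) * taylor_term v d \<xi>) \<le> ?C m d * norm \<xi> ^ Suc k"
      by (simp only: mult_ac)
  qed
qed

section \<open>The expansion of the Fourier transform divided by 1 - |\<xi>|^2\<close>

lemma geometric_remainder:
  fixes s :: real
  assumes "s \<noteq> 1"
  shows "1 / (1 - s) = (\<Sum>m\<le>M. s ^ m) + s ^ Suc M / (1 - s)"
  using assms sum_gp_basic[of s M] by (simp add: field_simps)

text \<open>\<open>A_profile\<close> and \<open>B_profile\<close> together are the expansion up to order \<open>k\<close> of
  \<open>fourier v\<close> times the geometric series of \<open>1 / (1 - |\<xi>|\<^sup>2)\<close>.\<close>

lemma norm_fourier_div_minus_profile_le:
  assumes v: "v \<in> L1_weighted (real k)" and "\<epsilon> > 0"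
  obtains C where "C \<ge> 0"
    "\<And>\<xi>. norm \<xi> \<le> 1 / 2 \<Longrightarrow>
      norm (of_real (1 / (1 - (norm \<xi>)\<^sup>2)) * fourier v \<xi> - (A_profile (int k - 1) v \<xi> + B_profile k v \<xi>))
        \<le> \<epsilon> * norm \<xi> ^ k + C * norm \<xi> ^ Suc k"
proof -
  let ?K = "\<lambda>j. \<integral>x. norm x ^ j * norm (v x) \<partial>lebesgue"
  let ?S = "\<lambda>\<xi> m. \<Sum>d\<le>m. taylor_term v d \<xi>"
  let ?M = "k div 2"
  obtain C0 where C0: "C0 \<ge> 0"
    and small: "\<And>\<xi>. norm (fourier v \<xi> - ?S \<xi> k) \<le> \<epsilon> * norm \<xi> ^ k + C0 * norm \<xi> ^ Suc k"
    using norm_fourier_minus_taylor_small[OF v \<open>\<epsilon> > 0\<close>] by blast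
  define C where "C = C0 + (\<Sum>m\<in>{1..?M}. ?K (Suc (k - 2 * m))) + 2 * ?K 0"
  show thesis
  proof
    show "0 \<le> C"
      unfolding C_def by (intro add_nonneg_nonneg sum_nonneg C0) simp_all
    fix \<xi> :: "real ^ 'a" assume \<xi>: "norm \<xi> \<le> 1 / 2"
    define s where "s = (norm \<xi>)\<^sup>2"
    have s: "s \<le> 1 / 4"
      using power_mono[OF \<xi>, of 2] by (simp add: s_def power2_eq_square)
    have spow: "norm \<xi> ^ (2 * m) = s ^ m" for m
      by (simp add: s_def power_mult)
    have "of_real (1 / (1 - s)) * fourier v \<xi> - (A_profile (int k - 1) v \<xi> + B_profile k v \<xi>) =
        (\<Sum>m\<le>?M. of_real (s ^ m) * (fourier v \<xi> - ?S \<xi> (k - 2 * m))) + of_real (s ^ Suc ?M / (1 - s)) * fourier v \<xi>"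
      using s unfolding A_profile_add_B_profile spow
      by (subst geometric_remainder[where M="?M"])
        (simp_all add: distrib_right right_diff_distrib sum_subtractf sum_distrib_right del: power_Suc)
    \<comment> \<open>Only m = 0 needs the Taylor remainder of the critical order k and yields the
      \<epsilon>-term. For m at least 1 the expansion stops at an order below k, so
      \<open>norm_fourier_minus_taylor_le\<close> gives total order k + 1.\<close>
    also have "(\<Sum>m\<le>?M. of_real (s ^ m) * (fourier v \<xi> - ?S \<xi> (k - 2 * m))) =
        (fourier v \<xi> - ?S \<xi> k) + (\<Sum>m\<in>{1..?M}. of_real (s ^ m) * (fourier v \<xi> - ?S \<xi> (k - 2 * m)))"
      by (simp add: atMost_atLeast0 sum.atLeast_Suc_atMost)
    also have "norm (\<dots> + of_real (s ^ Suc ?M / (1 - s)) * fourier v \<xi>) \<le>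
        (\<epsilon> * norm \<xi> ^ k + C0 * norm \<xi> ^ Suc k) + (\<Sum>m\<in>{1..?M}. ?K (Suc (k - 2 * m))) * norm \<xi> ^ Suc k
          + 2 * ?K 0 * norm \<xi> ^ Suc k"
    proof (intro norm_triangle_mono small)
      show "norm (\<Sum>m\<in>{1..?M}. of_real (s ^ m) * (fourier v \<xi> - ?S \<xi> (k - 2 * m)))
          \<le> (\<Sum>m\<in>{1..?M}. ?K (Suc (k - 2 * m))) * norm \<xi> ^ Suc k"
        unfolding sum_distrib_right
      proof (rule sum_norm_le)
        fix m assume m: "m \<in> {1..?M}"
        then have less: "k - 2 * m < k"
          by auto
        have "Suc k = 2 * m + Suc (k - 2 * m)"
          using m by auto
        then have pow: "norm \<xi> ^ Suc k = s ^ m * norm \<xi> ^ Suc (k - 2 * m)"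
          by (simp only: spow power_add)
        have "0 \<le> s"
          by (simp add: s_def)
        then show "norm (of_real (s ^ m) * (fourier v \<xi> - ?S \<xi> (k - 2 * m))) \<le> ?K (Suc (k - 2 * m)) * norm \<xi> ^ Suc k"
          unfolding pow norm_mult norm_of_real
          using mult_left_mono[OF norm_fourier_minus_taylor_le[OF v less, of \<xi>], of "s ^ m"]
          by (simp add: mult_ac del: power_Suc)
      qed
      have "s ^ Suc ?M = norm \<xi> ^ (2 * Suc ?M)"
        by (simp only: spow)
      \<comment> \<open>For both parities 2 * Suc (k div 2) is at least k + 1, and |\<xi>| is at
        most 1.\<close>
      also have "\<dots> \<le> norm \<xi> ^ Suc k"
        using \<xi> by (intro power_decreasing) auto
      finally have "s ^ Suc ?M / (1 - s) \<le> norm \<xi> ^ Suc k / (1 / 2)"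
        using s by (intro frac_le) auto
      moreover have "0 \<le> s ^ Suc ?M / (1 - s)"
        using s by (simp add: s_def)
      ultimately have "\<bar>s ^ Suc ?M / (1 - s)\<bar> \<le> norm \<xi> ^ Suc k / (1 / 2)"
        by (simp only: abs_of_nonneg)
      then have "\<bar>s ^ Suc ?M / (1 - s)\<bar> * norm (fourier v \<xi>) \<le> (norm \<xi> ^ Suc k / (1 / 2)) * ?K 0"
        using norm_fourier_le[of v \<xi>] by (intro mult_mono) auto
      then show "norm (of_real (s ^ Suc ?M / (1 - s)) * fourier v \<xi>) \<le> 2 * ?K 0 * norm \<xi> ^ Suc k"
        unfolding norm_mult norm_of_real by (simp add: mult_ac)
    qed
    also have "\<dots> = \<epsilon> * norm \<xi> ^ k + C * norm \<xi> ^ Suc k"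
      by (simp add: C_def algebra_simps)
    finally show "norm (of_real (1 / (1 - (norm \<xi>)\<^sup>2)) * fourier v \<xi> - (A_profile (int k - 1) v \<xi> + B_profile k v \<xi>))
        \<le> \<epsilon> * norm \<xi> ^ k + C * norm \<xi> ^ Suc k"
      unfolding s_def .
  qed
qed

text \<open>A mean value estimate, from 1 - exp (- x) \<le> x: both exponents are at least t / 4, so
  the slope in s is at most t exp (- t / 4). The bound passes through the removable singularity; at
  s = 1 itself division by zero gives 0.\<close>

lemma exp_diff_quotient_le:
  fixes s t :: real
  assumes "t \<ge> 0" "1 / 4 \<le> s"
  shows "\<bar>(exp (- t * s) - exp (- t)) / (1 - s)\<bar> \<le> t * exp (- t / 4)"
proof -
  have *: "\<bar>exp (- t * a) - exp (- t * b)\<bar> \<le> t * exp (- t / 4) * (b - a)" if "1 / 4 \<le> a" "a < b" for a b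
  proof -
    have "exp (- t * b) = exp (- t * a) * exp (- (t * (b - a)))"
      by (simp add: exp_add[symmetric] algebra_simps)
    moreover have "exp (- t * b) \<le> exp (- t * a)"
      using assms that by (simp add: mult_left_mono)
    ultimately have "\<bar>exp (- t * a) - exp (- t * b)\<bar> = exp (- t * a) * (1 - exp (- (t * (b - a))))"
      by (simp add: algebra_simps)
    also have "\<dots> \<le> exp (- t * a) * (t * (b - a))"
      using exp_ge_add_one_self[of "- (t * (b - a))"] by (intro mult_left_mono) auto
    also have "\<dots> \<le> exp (- t / 4) * (t * (b - a))"
      using assms that mult_left_mono[of "1/4" a t] by (intro mult_right_mono) auto
    finally show ?thesis
      by (simp add: mult_ac)
  qed
  consider "s = 1" | "s < 1" | "s > 1"
    by linarith
  then show ?thesis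
  proof cases
    case 1
    then show ?thesis using assms by simp
  next
    case 2
    then show ?thesis
      using *[of s 1] assms by (simp add: divide_le_eq)
  next
    case 3
    then show ?thesis
      using *[of 1 s] assms by (simp add: divide_le_eq abs_minus_commute)
  qed
qed

section \<open>Sums: squared norms, transforms and weighted integrability\<close>

lemma square_add_le: "(a + b)\<^sup>2 \<le> 2 * a\<^sup>2 + 2 * (b::real)\<^sup>2"
  using sum_squares_bound[of a b] by (simp add: power2_sum)

text \<open>Takes the place of the triangle inequality in L2, so that only integrals of squared
  norms are compared.\<close>

lemma norm_square_add_le:
  fixes a b :: "'a::real_normed_vector"
  shows "(norm (a + b))\<^sup>2 \<le> 2 * (norm a)\<^sup>2 + 2 * (norm b)\<^sup>2"
  by (rule order_trans[OF power_mono[OF norm_triangle_ineq] square_add_le]) simp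

lemma fourier_add:
  assumes "integrable lebesgue f" "integrable lebesgue g"
  shows "fourier (\<lambda>x. f x + g x) \<xi> = fourier f \<xi> + fourier (g :: real ^ 'n \<Rightarrow> complex) \<xi>"
proof -
  have "integrable lebesgue (\<lambda>x. exp (- \<i> * complex_of_real (x \<bullet> \<xi>)) * h x)"
    if h: "integrable lebesgue h" for h :: "real ^ 'n \<Rightarrow> complex"
  proof (rule Bochner_Integration.integrable_bound[OF h])
    have "(\<lambda>x. exp (- \<i> * complex_of_real (x \<bullet> \<xi>))) \<in> borel_measurable lebesgue"
      by (intro continuous_borel_measurable_lebesgue continuous_intros)
    then show "(\<lambda>x. exp (- \<i> * complex_of_real (x \<bullet> \<xi>)) * h x) \<in> borel_measurable lebesgue"
      using borel_measurable_integrable[OF h] by (rule borel_measurable_times)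
  qed (simp add: norm_mult)
  from this[OF assms(1)] this[OF assms(2)] show ?thesis
    by (simp add: fourier_def distrib_left)
qed

lemma L1_weighted_add:
  assumes "f \<in> L1_weighted \<gamma>" "g \<in> L1_weighted \<gamma>"
  shows "(\<lambda>x. f x + g x :: complex) \<in> L1_weighted \<gamma>"
proof -
  have [measurable]: "f \<in> borel_measurable lebesgue" "g \<in> borel_measurable lebesgue"
    "(\<lambda>x. (1 + norm x) powr \<gamma> * cmod (f x)) \<in> borel_measurable lebesgue"
    using assms by (auto simp: L1_weighted_def)
  have w: "(\<lambda>x::real ^ 'a. (1 + norm x) powr \<gamma>) \<in> borel_measurable lebesgue"
    by (intro measurable_completion) simp
  have "integrable lebesgue (\<lambda>x. (1 + norm x) powr \<gamma> * cmod (f x + g x))"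
  proof (rule Bochner_Integration.integrable_bound)
    show "integrable lebesgue (\<lambda>x. (1 + norm x) powr \<gamma> * cmod (f x) + (1 + norm x) powr \<gamma> * cmod (g x))"
      using assms by (simp add: L1_weighted_def)
    show "(\<lambda>x. (1 + norm x) powr \<gamma> * cmod (f x + g x)) \<in> borel_measurable lebesgue"
      by (intro borel_measurable_times w) measurable
    have "(1 + norm x) powr \<gamma> * cmod (f x + g x) \<le> (1 + norm x) powr \<gamma> * cmod (f x) + (1 + norm x) powr \<gamma> * cmod (g x)" for x
      unfolding distrib_left[symmetric] by (intro mult_left_mono norm_triangle_ineq) simp
    then show "AE x in lebesgue. norm ((1 + norm x) powr \<gamma> * cmod (f x + g x))
        \<le> norm ((1 + norm x) powr \<gamma> * cmod (f x) + (1 + norm x) powr \<gamma> * cmod (g x))"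
      by (simp add: abs_of_nonneg)
  qed
  then show ?thesis
    using assms by (simp add: L1_weighted_def)
qed

section \<open>The remainder estimate\<close>

text \<open>The bound is pointwise and global in \<xi>: the first summand scales as a Gaussian
  moment, the second is the square-integrable data times an exponentially small factor. The factor
  16 is 2 * 4 * 2, from doubling the squares, from squaring 2 E, and from separating the two
  data.\<close>

lemma norm_u_hat_minus_profile_sq_le:
  fixes u0 u1 v :: "real ^ 'n \<Rightarrow> complex"
  assumes u0: "u0 \<in> L1_weighted (real k)" and u1: "u1 \<in> L1_weighted (real k)"
    and v: "v = (\<lambda>x. u0 x + u1 x)" and \<epsilon>: "\<epsilon> > 0"
  obtains C where "C \<ge> 0"
    "\<And>t \<xi>. 1 \<le> t \<Longrightarrow>
      (norm (u_hat u0 u1 t \<xi> - (A_profile (int k - 1) v \<xi> + B_profile k v \<xi>) * of_real (exp (- t * (norm \<xi>)\<^sup>2))))\<^sup>2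
        \<le> (\<epsilon> * norm \<xi> ^ (2 * k) + C * norm \<xi> ^ (2 * Suc k)) * exp (- 2 * t * (norm \<xi>)\<^sup>2)
          + 16 * (t\<^sup>2 * exp (- t / 2)) * ((norm (fourier u0 \<xi>))\<^sup>2 + (norm (fourier u1 \<xi>))\<^sup>2)"
proof -
  have vL: "v \<in> L1_weighted (real k)"
    unfolding v by (rule L1_weighted_add[OF u0 u1])
  let ?P = "\<lambda>\<xi>. A_profile (int k - 1) v \<xi> + B_profile k v \<xi>"
  \<comment> \<open>Two doublings of squares follow, so the square of sqrt \<epsilon> / 2 ends up as
    \<epsilon>. For the same reason \<open>C\<close> below contains 4 C1^2, but only 2 C2^2, since
    the far region undergoes a single doubling.\<close>
  obtain C1 where C1: "C1 \<ge> 0" and near: "\<And>\<xi>. norm \<xi> \<le> 1 / 2 \<Longrightarrow>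
      norm (of_real (1 / (1 - (norm \<xi>)\<^sup>2)) * fourier v \<xi> - ?P \<xi>)
        \<le> sqrt \<epsilon> / 2 * norm \<xi> ^ k + C1 * norm \<xi> ^ Suc k"
    using norm_fourier_div_minus_profile_le[OF vL, of "sqrt \<epsilon> / 2"] \<epsilon> by (metis half_gt_zero real_sqrt_gt_0_iff)
  obtain C2 where C2: "C2 \<ge> 0" and far: "\<And>\<xi>. 1 / 2 \<le> norm \<xi> \<Longrightarrow> norm (?P \<xi>) \<le> C2 * norm \<xi> ^ Suc k"
    using norm_A_add_B_profile_le[OF vL] by blast
  define C where "C = 4 * C1\<^sup>2 + 2 * C2\<^sup>2"
  show thesis
  proof
    show "0 \<le> C"
      by (simp add: C_def)
    fix t :: real and \<xi> :: "real ^ 'n"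
    assume t: "1 \<le> t"
    define s where "s = (norm \<xi>)\<^sup>2"
    define a where "a = fourier u0 \<xi>"
    define b where "b = fourier u1 \<xi>"
    define E where "E = t * exp (- t / 4)"
    have ab: "fourier v \<xi> = a + b"
      unfolding v a_def b_def using u0 u1 by (intro fourier_add L1_weighted_integrable)
    have E0: "0 \<le> E"
      using t by (simp add: E_def)
    have E2: "E\<^sup>2 = t\<^sup>2 * exp (- t / 2)"
      by (simp add: E_def power_mult_distrib exp_double[symmetric])
    have e1: "(exp (- t * s))\<^sup>2 = exp (- 2 * t * s)"
      by (simp add: exp_double[symmetric] mult_ac)
    have e2: "exp (- t) \<le> E"
    proof -
      have "1 * exp (- t) \<le> t * exp (- t / 4)"
        using t by (intro mult_mono) auto
      then show ?thesis
        by (simp add: E_def)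
    qed
    have ab2: "(norm a + norm b)\<^sup>2 \<le> 2 * ((norm a)\<^sup>2 + (norm b)\<^sup>2)"
      using square_add_le[of "norm a" "norm b"] by simp
    have pow: "(norm \<xi> ^ j)\<^sup>2 = norm \<xi> ^ (2 * j)" for j
      by (simp add: power_mult mult.commute[of 2])
    have u: "u_hat u0 u1 t \<xi> = of_real ((exp (- t * s) - s * exp (- t)) / (1 - s)) * a + of_real ((exp (- t * s) - exp (- t)) / (1 - s)) * b"
      by (simp add: u_hat_def s_def a_def b_def)
    \<comment> \<open>Common end of both regions: \<open>X\<close> has Gaussian decay in \<xi>,
      \<open>Y\<close> is exponentially small in t.\<close>
    have final: "(norm (X + Y))\<^sup>2 \<le> (\<epsilon> * norm \<xi> ^ (2 * k) + C * norm \<xi> ^ (2 * Suc k)) * exp (- 2 * t * s) + 16 * E\<^sup>2 * ((norm a)\<^sup>2 + (norm b)\<^sup>2)"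
      if X: "(norm X)\<^sup>2 \<le> (\<epsilon> / 2 * norm \<xi> ^ (2 * k) + C / 2 * norm \<xi> ^ (2 * Suc k)) * exp (- 2 * t * s)"
        and Y: "norm Y \<le> 2 * E * (norm a + norm b)" for X Y :: complex
    proof -
      have "(norm Y)\<^sup>2 \<le> (2 * E * (norm a + norm b))\<^sup>2"
        using Y by (intro power_mono) auto
      also have "\<dots> = 4 * E\<^sup>2 * (norm a + norm b)\<^sup>2"
        by (simp add: power_mult_distrib)
      also have "\<dots> \<le> 4 * E\<^sup>2 * (2 * ((norm a)\<^sup>2 + (norm b)\<^sup>2))"
        by (intro mult_left_mono ab2) simp
      finally have "2 * (norm Y)\<^sup>2 \<le> 16 * E\<^sup>2 * ((norm a)\<^sup>2 + (norm b)\<^sup>2)"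
        by (simp only: mult.assoc mult_le_cancel_left_pos)
      moreover have "2 * (norm X)\<^sup>2 \<le> (\<epsilon> * norm \<xi> ^ (2 * k) + C * norm \<xi> ^ (2 * Suc k)) * exp (- 2 * t * s)"
        using X by (simp add: algebra_simps)
      ultimately show ?thesis
        using norm_square_add_le[of X Y] by linarith
    qed
    have "(norm (u_hat u0 u1 t \<xi> - ?P \<xi> * of_real (exp (- t * s))))\<^sup>2
        \<le> (\<epsilon> * norm \<xi> ^ (2 * k) + C * norm \<xi> ^ (2 * Suc k)) * exp (- 2 * t * s) + 16 * E\<^sup>2 * ((norm a)\<^sup>2 + (norm b)\<^sup>2)"
    proof (cases "norm \<xi> \<le> 1 / 2")
      case True
      have s: "0 \<le> s" "s \<le> 1 / 4"
        using power_mono[OF True, of 2] by (simp_all add: s_def power2_eq_square)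
      \<comment> \<open>Collecting the terms with exp (- t s), the two data enter only through their
        sum \<open>v\<close>; all terms with exp (- t) go into \<open>Y\<close>.\<close>
      define X where "X = of_real (exp (- t * s)) * (of_real (1 / (1 - s)) * fourier v \<xi> - ?P \<xi>)"
      define Y where "Y = - of_real (exp (- t) / (1 - s)) * (of_real s * a + b)"
      have XY: "u_hat u0 u1 t \<xi> - ?P \<xi> * of_real (exp (- t * s)) = X + Y"
        unfolding u X_def Y_def ab using s
        by (simp add: diff_divide_distrib add_divide_distrib algebra_simps)
      show ?thesis
        unfolding XY
      proof (rule final)
        have "norm X \<le> exp (- t * s) * (sqrt \<epsilon> / 2 * norm \<xi> ^ k + C1 * norm \<xi> ^ Suc k)"
          unfolding X_def norm_mult norm_of_real abs_exp_cancel s_def by (intro mult_left_mono near True) simp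
        then have "(norm X)\<^sup>2 \<le> (exp (- t * s) * (sqrt \<epsilon> / 2 * norm \<xi> ^ k + C1 * norm \<xi> ^ Suc k))\<^sup>2"
          by (intro power_mono) auto
        also have "\<dots> = exp (- 2 * t * s) * (sqrt \<epsilon> / 2 * norm \<xi> ^ k + C1 * norm \<xi> ^ Suc k)\<^sup>2"
          by (simp only: power_mult_distrib e1)
        also have "\<dots> \<le> exp (- 2 * t * s) * (2 * (sqrt \<epsilon> / 2 * norm \<xi> ^ k)\<^sup>2 + 2 * (C1 * norm \<xi> ^ Suc k)\<^sup>2)"
          by (intro mult_left_mono square_add_le) simp
        also have "\<dots> = exp (- 2 * t * s) * (\<epsilon> / 2 * norm \<xi> ^ (2 * k) + 2 * C1\<^sup>2 * norm \<xi> ^ (2 * Suc k))"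
          unfolding power_mult_distrib pow power_divide using \<epsilon> by simp
        also have "\<dots> \<le> exp (- 2 * t * s) * (\<epsilon> / 2 * norm \<xi> ^ (2 * k) + C / 2 * norm \<xi> ^ (2 * Suc k))"
          by (intro mult_left_mono add_left_mono mult_right_mono) (auto simp: C_def)
        finally show "(norm X)\<^sup>2 \<le> (\<epsilon> / 2 * norm \<xi> ^ (2 * k) + C / 2 * norm \<xi> ^ (2 * Suc k)) * exp (- 2 * t * s)"
          by (simp only: mult.commute)
        have "norm (of_real s * a + b) \<le> 1 * norm a + norm b"
          using s by (intro norm_triangle_mono) (auto simp: norm_mult intro!: mult_left_le_one_le)
        moreover have "exp (- t) / (1 - s) \<le> E / (1 / 2)"
          using s e2 t by (intro frac_le) (auto simp: E_def)
        ultimately show "norm Y \<le> 2 * E * (norm a + norm b)"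
          unfolding Y_def norm_mult norm_minus_cancel norm_of_real using s E0
          by (intro mult_mono) auto
      qed
    next
      case False
      have s: "1 / 4 \<le> s"
        using power_mono[of "1 / 2" "norm \<xi>" 2] False by (simp add: s_def power2_eq_square)
      \<comment> \<open>Away from the origin nothing has to cancel: the profile and the solution are
        each small by themselves.\<close>
      define X where "X = - (?P \<xi> * of_real (exp (- t * s)))"
      have XY: "u_hat u0 u1 t \<xi> - ?P \<xi> * of_real (exp (- t * s)) = X + u_hat u0 u1 t \<xi>"
        by (simp add: X_def)
      show ?thesis
        unfolding XY
      proof (rule final)
        have "norm X \<le> (C2 * norm \<xi> ^ Suc k) * exp (- t * s)"
          unfolding X_def norm_minus_cancel norm_mult norm_of_real abs_exp_cancel
          using False by (intro mult_right_mono far) auto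
        then have "(norm X)\<^sup>2 \<le> ((C2 * norm \<xi> ^ Suc k) * exp (- t * s))\<^sup>2"
          by (intro power_mono) auto
        also have "\<dots> = (C2\<^sup>2 * norm \<xi> ^ (2 * Suc k)) * exp (- 2 * t * s)"
          by (simp only: power_mult_distrib e1 pow)
        also have "\<dots> \<le> (\<epsilon> / 2 * norm \<xi> ^ (2 * k) + C / 2 * norm \<xi> ^ (2 * Suc k)) * exp (- 2 * t * s)"
        proof (rule mult_right_mono)
          have "C2\<^sup>2 * norm \<xi> ^ (2 * Suc k) \<le> C / 2 * norm \<xi> ^ (2 * Suc k)"
            by (intro mult_right_mono) (auto simp: C_def)
          moreover have "0 \<le> \<epsilon> / 2 * norm \<xi> ^ (2 * k)"
            using \<epsilon> by simp
          ultimately show "C2\<^sup>2 * norm \<xi> ^ (2 * Suc k) \<le> \<epsilon> / 2 * norm \<xi> ^ (2 * k) + C / 2 * norm \<xi> ^ (2 * Suc k)"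
            by linarith
        qed simp
        finally show "(norm X)\<^sup>2 \<le> (\<epsilon> / 2 * norm \<xi> ^ (2 * k) + C / 2 * norm \<xi> ^ (2 * Suc k)) * exp (- 2 * t * s)" .
        have q: "\<bar>(exp (- t * s) - exp (- t)) / (1 - s)\<bar> \<le> E"
          unfolding E_def using t s by (intro exp_diff_quotient_le) auto
        have "\<bar>(exp (- t * s) - s * exp (- t)) / (1 - s)\<bar> \<le> 2 * E"
        proof (cases "s = 1")
          case True
          then show ?thesis using t by (simp add: E_def)
        next
          case False
          \<comment> \<open>Reduces the symbol of \<open>u0\<close> to the difference quotient
            already bounded; the split moves exp (- t) (1 - s) out of the numerator.\<close>
          then have "(exp (- t * s) - s * exp (- t)) / (1 - s) = (exp (- t * s) - exp (- t)) / (1 - s) + exp (- t)"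
            by (simp add: field_simps)
          with q e2 show ?thesis
            using abs_triangle_ineq[of "(exp (- t * s) - exp (- t)) / (1 - s)" "exp (- t)"] by (simp del: minus_mult_left)
        qed
        moreover have "\<bar>(exp (- t * s) - exp (- t)) / (1 - s)\<bar> \<le> 2 * E"
          using q by linarith
        ultimately show "norm (u_hat u0 u1 t \<xi>) \<le> 2 * E * (norm a + norm b)"
          unfolding u distrib_left
          by (intro norm_triangle_mono) (simp_all only: norm_mult norm_of_real mult_right_mono norm_ge_zero)
      qed
    qed
    then show "(norm (u_hat u0 u1 t \<xi> - ?P \<xi> * of_real (exp (- t * (norm \<xi>)\<^sup>2))))\<^sup>2
        \<le> (\<epsilon> * norm \<xi> ^ (2 * k) + C * norm \<xi> ^ (2 * Suc k)) * exp (- 2 * t * (norm \<xi>)\<^sup>2)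
          + 16 * (t\<^sup>2 * exp (- t / 2)) * ((norm (fourier u0 \<xi>))\<^sup>2 + (norm (fourier u1 \<xi>))\<^sup>2)"
      unfolding E2 s_def a_def b_def .
  qed
qed

section \<open>Gaussian moments and their scaling in t\<close>

lemma integrable_power_mult_gaussian:
  "integrable lborel (\<lambda>y::'a::euclidean_space. norm y ^ (2 * j) * exp (- 2 * (norm y)\<^sup>2))"
proof (rule Bochner_Integration.integrable_bound)
  show "integrable lborel (\<lambda>y::'a. max 1 (real j ^ j) * exp (- (norm y)\<^sup>2 / 2))"
    using integrable_gaussian_euclidean[where 'a='a] by simp
  have "norm y ^ (2 * j) * exp (- 2 * (norm y)\<^sup>2) \<le> max 1 (real j ^ j) * exp (- (norm y)\<^sup>2 / 2)" for y :: 'a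
  proof -
    \<comment> \<open>With x = |y|^2 this is (x / j)^j \<le> exp x. Half of the exponent 2 |y|^2 is
      thus spent on the power, and the rest still decays.\<close>
    have "((norm y)\<^sup>2) ^ j \<le> max 1 (real j ^ j) * exp ((norm y)\<^sup>2)"
    proof (cases "j = 0")
      case False
      have "(norm y)\<^sup>2 / j \<le> exp ((norm y)\<^sup>2 / j)"
        using exp_ge_add_one_self[of "(norm y)\<^sup>2 / j"] by linarith
      then have "((norm y)\<^sup>2 / j) ^ j \<le> exp ((norm y)\<^sup>2 / j) ^ j"
        by (intro power_mono) auto
      also have "\<dots> = exp ((norm y)\<^sup>2)"
        using False by (simp add: exp_of_nat_mult[symmetric])
      finally have "((norm y)\<^sup>2) ^ j \<le> real j ^ j * exp ((norm y)\<^sup>2)"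
        using False by (simp add: power_divide divide_le_eq mult.commute)
      also have "\<dots> \<le> max 1 (real j ^ j) * exp ((norm y)\<^sup>2)"
        by (intro mult_right_mono) auto
      finally show ?thesis .
    qed simp
    then have "norm y ^ (2 * j) * exp (- 2 * (norm y)\<^sup>2) \<le> max 1 (real j ^ j) * exp ((norm y)\<^sup>2) * exp (- 2 * (norm y)\<^sup>2)"
      by (intro mult_right_mono) (simp_all add: power_mult)
    also have "\<dots> = max 1 (real j ^ j) * exp (- (norm y)\<^sup>2)"
      by (simp add: exp_add[symmetric] mult.assoc)
    also have "\<dots> \<le> max 1 (real j ^ j) * exp (- (norm y)\<^sup>2 / 2)"
      by (intro mult_left_mono) auto
    finally show ?thesis .
  qed
  then show "AE y in lborel. norm (norm (y::'a) ^ (2 * j) * exp (- 2 * (norm y)\<^sup>2)) \<le> norm (max 1 (real j ^ j) * exp (- (norm y)\<^sup>2 / 2))"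
    by (intro AE_I2) (simp add: abs_mult)
qed measurable

text \<open>The substitution of sqrt t y for y gives the exact value. The \<epsilon>-term thus has
  the same power of t as the leading part, and one further factor |\<xi>|^2 gains exactly 1 /
  t.\<close>

lemma has_bochner_integral_homogeneous_mult_gaussian:
  fixes h :: "'a::euclidean_space \<Rightarrow> real"
  assumes h: "\<And>c y. 0 < c \<Longrightarrow> h (c *\<^sub>R y) = c ^ (2 * j) * h y"
    and int: "integrable lborel (\<lambda>y. h y * exp (- 2 * (norm y)\<^sup>2))" and t: "0 < t"
  shows "has_bochner_integral lborel (\<lambda>y. h y * exp (- 2 * t * (norm y)\<^sup>2))
    (t powr (- real DIM('a) / 2 - real j) * (\<integral>y. h y * exp (- 2 * (norm y)\<^sup>2) \<partial>lborel))"
proof -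
  let ?I = "\<integral>y. h y * exp (- 2 * (norm y)\<^sup>2) \<partial>lborel"
  have "has_bochner_integral lborel (\<lambda>y. h (sqrt t *\<^sub>R y) * exp (- 2 * (norm (sqrt t *\<^sub>R y))\<^sup>2)) (?I /\<^sub>R \<bar>sqrt t\<bar> ^ DIM('a))"
    using int t by (intro has_bochner_integral_lborel_scaleR) (auto simp: has_bochner_integral_iff)
  then have "has_bochner_integral lborel (\<lambda>y. t powr (- real j) * (h (sqrt t *\<^sub>R y) * exp (- 2 * (norm (sqrt t *\<^sub>R y))\<^sup>2)))
      (t powr (- real j) * (?I /\<^sub>R \<bar>sqrt t\<bar> ^ DIM('a)))"
    by (rule has_bochner_integral_mult_right)
  moreover have "(\<lambda>y. t powr (- real j) * (h (sqrt t *\<^sub>R y) * exp (- 2 * (norm (sqrt t *\<^sub>R y))\<^sup>2))) = (\<lambda>y. h y * exp (- 2 * t * (norm y)\<^sup>2))"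
    using t by (simp add: fun_eq_iff h power_mult powr_minus powr_realpow power_mult_distrib mult.assoc)
  moreover have "t powr (- real j) * (?I /\<^sub>R \<bar>sqrt t\<bar> ^ DIM('a)) = t powr (- real DIM('a) / 2 - real j) * ?I"
  proof -
    have "\<bar>sqrt t\<bar> ^ DIM('a) = t powr (real DIM('a) / 2)"
      using t by (simp add: powr_half_sqrt[symmetric] powr_realpow[symmetric] powr_powr)
    then have "?I /\<^sub>R \<bar>sqrt t\<bar> ^ DIM('a) = t powr (- (real DIM('a) / 2)) * ?I"
      by (simp only: powr_minus real_scaleR_def)
    then have "t powr (- real j) * (?I /\<^sub>R \<bar>sqrt t\<bar> ^ DIM('a)) = t powr (- real j + - (real DIM('a) / 2)) * ?I"
      by (simp only: powr_add mult.assoc)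
    also have "- real j + - (real DIM('a) / 2) = - real DIM('a) / 2 - real j"
      by simp
    finally show ?thesis .
  qed
  ultimately show ?thesis
    by (simp only:)
qed

lemma L2_borel:
  fixes f :: "real ^ 'n \<Rightarrow> complex"
  assumes "f \<in> borel_measurable borel" "integrable lborel (\<lambda>\<xi>. (norm (f \<xi>))\<^sup>2)"
  shows "f \<in> L2" and "L2_norm f = sqrt (\<integral>\<xi>. (norm (f \<xi>))\<^sup>2 \<partial>lborel)"
proof -
  note [measurable] = assms(1)
  show "f \<in> L2"
    using assms unfolding L2_def by (auto simp: integrable_completion measurable_completion)
  show "L2_norm f = sqrt (\<integral>\<xi>. (norm (f \<xi>))\<^sup>2 \<partial>lborel)"
    unfolding L2_norm_on_def set_lebesgue_integral_def by (simp add: integral_completion)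
qed

section \<open>The two-sided bound\<close>

theorem corollary4p1:
  fixes u0 u1 v :: "real ^ 'n \<Rightarrow> complex" and k :: nat
  assumes "u0 \<in> L2 \<inter> L1_weighted (real k)"
    and "u1 \<in> L2 \<inter> L1_weighted (real k)"
    and "v = (\<lambda>x. u0 x + u1 x)"
  shows "\<exists>C \<delta> :: real. C > 0 \<and> \<delta> \<ge> 1 \<and>
    (\<forall>t\<ge>\<delta>.
       (\<lambda>\<xi>. u_hat u0 u1 t \<xi>
          - A_profile (int k - 1) v \<xi> * complex_of_real (exp (- t * (norm \<xi>)\<^sup>2))) \<in> L2 \<and>
       1 / 2 * L2_norm_on {\<xi>. norm \<xi> \<le> 1 / 2}
                 (\<lambda>\<xi>. B_profile k v \<xi> * complex_of_real (exp (- (norm \<xi>)\<^sup>2)))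
             * t powr (- real CARD('n) / 4 - real k / 2)
         \<le> L2_norm (\<lambda>\<xi>. u_hat u0 u1 t \<xi>
             - A_profile (int k - 1) v \<xi> * complex_of_real (exp (- t * (norm \<xi>)\<^sup>2))) \<and>
       L2_norm (\<lambda>\<xi>. u_hat u0 u1 t \<xi>
             - A_profile (int k - 1) v \<xi> * complex_of_real (exp (- t * (norm \<xi>)\<^sup>2)))
         \<le> C * t powr (- real CARD('n) / 4 - real k / 2))"
proof -
  have u0: "u0 \<in> L1_weighted (real k)" and u1: "u1 \<in> L1_weighted (real k)"
    using assms(1,2) by auto
  note int0 = L1_weighted_integrable[OF u0] and int1 = L1_weighted_integrable[OF u1]
  have vL: "v \<in> L1_weighted (real k)"
    unfolding assms(3) by (rule L1_weighted_add[OF u0 u1])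
  note [measurable] = borel_measurable_fourier[OF int0] borel_measurable_fourier[OF int1]
    borel_measurable_A_profile_pred[of k v] borel_measurable_B_profile[of k v]
  \<comment> \<open>Twice the exponent of the theorem, since squared norms are estimated
    throughout.\<close>
  define p where "p = - real CARD('n) / 2 - real k"
  define D where "D t \<xi> = u_hat u0 u1 t \<xi> - A_profile (int k - 1) v \<xi> * complex_of_real (exp (- t * (norm \<xi>)\<^sup>2))" for t \<xi>
  define BE where "BE t \<xi> = B_profile k v \<xi> * complex_of_real (exp (- t * (norm \<xi>)\<^sup>2))" for t \<xi>
  define R where "R t \<xi> = D t \<xi> - BE t \<xi>" for t \<xi>
  have [measurable]: "D t \<in> borel_measurable borel" "BE t \<in> borel_measurable borel" for t
    unfolding D_def[abs_def] BE_def[abs_def] u_hat_def by measurable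
  have Rm[measurable]: "R t \<in> borel_measurable borel" for t
    unfolding R_def[abs_def] by measurable
  define Q where "Q = (\<integral>\<xi>. (norm (fourier u0 \<xi>))\<^sup>2 + (norm (fourier u1 \<xi>))\<^sup>2 \<partial>lborel)"
  have intQ: "integrable lborel (\<lambda>\<xi>. (norm (fourier u0 \<xi>))\<^sup>2 + (norm (fourier u1 \<xi>))\<^sup>2)"
    using integrable_norm_fourier_sq[OF int0] integrable_norm_fourier_sq[OF int1] assms(1,2) by auto
  define I where "I j = (\<integral>\<xi>. norm (\<xi>::real ^ 'n) ^ (2 * j) * exp (- 2 * (norm \<xi>)\<^sup>2) \<partial>lborel)" for j
  have hI: "has_bochner_integral lborel (\<lambda>\<xi>::real ^ 'n. norm \<xi> ^ (2 * j) * exp (- 2 * t * (norm \<xi>)\<^sup>2))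
      (t powr (- real CARD('n) / 2 - real j) * I j)" if "0 < t" for t j
    using has_bochner_integral_homogeneous_mult_gaussian[of "\<lambda>\<xi>::real ^ 'n. norm \<xi> ^ (2 * j)" j t]
      integrable_power_mult_gaussian[where 'a="real ^ 'n" and j=j] that
    by (simp add: I_def power_mult_distrib)
  define IB where "IB = (\<integral>\<xi>. (norm (B_profile k v \<xi>))\<^sup>2 * exp (- 2 * (norm \<xi>)\<^sup>2) \<partial>lborel)"
  have intB: "integrable lborel (\<lambda>\<xi>. (norm (B_profile k v \<xi>))\<^sup>2 * exp (- 2 * (norm \<xi>)\<^sup>2))"
  proof -
    obtain C where C: "C \<ge> 0" "\<And>\<xi>. norm (B_profile k v \<xi>) \<le> C * norm \<xi> ^ k"
      using norm_B_profile_le[OF vL] by blast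
    show ?thesis
    proof (rule Bochner_Integration.integrable_bound)
      show "integrable lborel (\<lambda>\<xi>::real ^ 'n. C\<^sup>2 * (norm \<xi> ^ (2 * k) * exp (- 2 * (norm \<xi>)\<^sup>2)))"
        by (intro Bochner_Integration.integrable_mult_right integrable_power_mult_gaussian)
      have "(norm (B_profile k v \<xi>))\<^sup>2 \<le> C\<^sup>2 * norm \<xi> ^ (2 * k)" for \<xi>
        using power_mono[OF C(2) norm_ge_zero, of \<xi> 2] by (simp add: power_mult_distrib power_mult mult.commute[of 2])
      then have "(norm (B_profile k v \<xi>))\<^sup>2 * exp (- 2 * (norm \<xi>)\<^sup>2) \<le> (C\<^sup>2 * norm \<xi> ^ (2 * k)) * exp (- 2 * (norm \<xi>)\<^sup>2)" for \<xi>
        by (rule mult_right_mono) simp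
      then show "AE \<xi> in lborel. norm ((norm (B_profile k v \<xi>))\<^sup>2 * exp (- 2 * (norm \<xi>)\<^sup>2))
          \<le> norm (C\<^sup>2 * (norm \<xi> ^ (2 * k) * exp (- 2 * (norm \<xi>)\<^sup>2)))"
        by (simp add: mult.assoc abs_mult)
    qed measurable
  qed
  have hB: "has_bochner_integral lborel (\<lambda>\<xi>. (norm (BE t \<xi>))\<^sup>2) (t powr p * IB)" if "0 < t" for t
  proof -
    have "(norm (BE t \<xi>))\<^sup>2 = (norm (B_profile k v \<xi>))\<^sup>2 * exp (- 2 * t * (norm \<xi>)\<^sup>2)" for \<xi>
      by (simp add: BE_def norm_mult power_mult_distrib exp_double[symmetric] mult_ac)
    moreover have "has_bochner_integral lborel (\<lambda>\<xi>. (norm (B_profile k v \<xi>))\<^sup>2 * exp (- 2 * t * (norm \<xi>)\<^sup>2))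
        (t powr (- real DIM(real ^ 'n) / 2 - real k) * IB)"
      unfolding IB_def using that intB
      by (intro has_bochner_integral_homogeneous_mult_gaussian)
        (auto simp: B_profile_scaleR norm_mult power_mult_distrib norm_power power_mult mult.commute[of 2])
    ultimately show ?thesis
      by (simp add: p_def)
  qed
  have IB0: "0 \<le> IB"
    by (simp add: IB_def)
  have I0: "0 \<le> I j" for j
    by (simp add: I_def)
  \<comment> \<open>The share of t^p allowed to the squared remainder. From N \<ge> IB / 2 -
    \<beta>, with N the squared norm over t^p, the choice IB / 4 leaves IB / 4. If \<open>IB\<close>
    is 0, any positive value serves, as only the upper bound has content.\<close>
  define \<beta> where "\<beta> = (if IB = 0 then 1 else IB / 4)"
  have \<beta>: "0 < \<beta>"
    using IB0 by (simp add: \<beta>_def)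
  \<comment> \<open>One third of \<beta> goes to the \<epsilon>-term; adding 1 keeps the denominator
    positive.\<close>
  define \<epsilon> where "\<epsilon> = \<beta> / (3 * (I k + 1))"
  have \<epsilon>: "0 < \<epsilon>" and \<epsilon>I: "\<epsilon> * I k \<le> \<beta> / 3"
    using \<beta> I0[of k] by (auto simp: \<epsilon>_def field_simps add_pos_nonneg)
  obtain C where C: "C \<ge> 0"
    and bound: "\<And>t \<xi>. 1 \<le> t \<Longrightarrow> (norm (R t \<xi>))\<^sup>2
        \<le> (\<epsilon> * norm \<xi> ^ (2 * k) + C * norm \<xi> ^ (2 * Suc k)) * exp (- 2 * t * (norm \<xi>)\<^sup>2)
          + 16 * (t\<^sup>2 * exp (- t / 2)) * ((norm (fourier u0 \<xi>))\<^sup>2 + (norm (fourier u1 \<xi>))\<^sup>2)"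
    using norm_u_hat_minus_profile_sq_le[OF u0 u1 assms(3) \<epsilon>]
    unfolding R_def D_def BE_def diff_diff_eq distrib_right[symmetric] by blast
  have R: "integrable lborel (\<lambda>\<xi>. (norm (R t \<xi>))\<^sup>2)"
    "(\<integral>\<xi>. (norm (R t \<xi>))\<^sup>2 \<partial>lborel) \<le> t powr p * (\<beta> / 3) + C * (t powr (p - 1) * I (Suc k)) + 16 * (t\<^sup>2 * exp (- t / 2)) * Q"
    if t: "1 \<le> t" for t
  proof -
    let ?r = "\<lambda>\<xi>. \<epsilon> * (norm \<xi> ^ (2 * k) * exp (- 2 * t * (norm \<xi>)\<^sup>2)) + C * (norm \<xi> ^ (2 * Suc k) * exp (- 2 * t * (norm \<xi>)\<^sup>2))
          + 16 * (t\<^sup>2 * exp (- t / 2)) * ((norm (fourier u0 \<xi>))\<^sup>2 + (norm (fourier u1 \<xi>))\<^sup>2)"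
    have "has_bochner_integral lborel ?r (\<epsilon> * (t powr (- real CARD('n) / 2 - real k) * I k)
        + C * (t powr (- real CARD('n) / 2 - real (Suc k)) * I (Suc k)) + 16 * (t\<^sup>2 * exp (- t / 2)) * Q)"
      using t intQ by (intro has_bochner_integral_add has_bochner_integral_mult_right hI) (auto simp: Q_def has_bochner_integral_iff)
    then have r: "integrable lborel ?r" "(\<integral>\<xi>. ?r \<xi> \<partial>lborel) = t powr p * (\<epsilon> * I k)
        + C * (t powr (p - 1) * I (Suc k)) + 16 * (t\<^sup>2 * exp (- t / 2)) * Q"
      by (simp_all add: has_bochner_integral_iff p_def algebra_simps)
    have le: "(norm (R t \<xi>))\<^sup>2 \<le> ?r \<xi>" for \<xi>
      using bound[OF t, of \<xi>] by (simp only: distrib_right mult.assoc)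
    show int: "integrable lborel (\<lambda>\<xi>. (norm (R t \<xi>))\<^sup>2)"
    proof (rule Bochner_Integration.integrable_bound[OF r(1)])
      show "AE \<xi> in lborel. norm ((norm (R t \<xi>))\<^sup>2) \<le> norm (?r \<xi>)"
        using le order_trans[OF zero_le_power2 le]
        by (intro AE_I2) (simp only: real_norm_def abs_of_nonneg zero_le_power2)
    qed measurable
    have "(\<integral>\<xi>. (norm (R t \<xi>))\<^sup>2 \<partial>lborel) \<le> (\<integral>\<xi>. ?r \<xi> \<partial>lborel)"
      by (intro integral_mono int r(1) le)
    also have "\<dots> \<le> t powr p * (\<beta> / 3) + C * (t powr (p - 1) * I (Suc k)) + 16 * (t\<^sup>2 * exp (- t / 2)) * Q"
      unfolding r(2) by (intro add_right_mono mult_left_mono \<epsilon>I) simp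
    finally show "(\<integral>\<xi>. (norm (R t \<xi>))\<^sup>2 \<partial>lborel) \<le> t powr p * (\<beta> / 3) + C * (t powr (p - 1) * I (Suc k)) + 16 * (t\<^sup>2 * exp (- t / 2)) * Q" .
  qed
  \<comment> \<open>The other two thirds of \<beta>: relative to t^p, the |\<xi>|^(k+1) term decays
    as 1 / t and the data term exponentially up to powers of t.\<close>
  have "((\<lambda>t. C * (1 / t) * I (Suc k)) \<longlongrightarrow> C * 0 * I (Suc k)) at_top"
    by (intro tendsto_intros) real_asymp
  then have "\<forall>\<^sub>F t in at_top. C * (1 / t) * I (Suc k) < \<beta> / 3"
    using \<beta> by (intro order_tendstoD(2)) auto
  moreover have "((\<lambda>t::real. 16 * (t\<^sup>2 * exp (- t / 2) * t powr (- p)) * Q) \<longlongrightarrow> 16 * 0 * Q) at_top"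
    by (intro tendsto_intros) real_asymp
  then have "\<forall>\<^sub>F t in at_top. 16 * (t\<^sup>2 * exp (- t / 2) * t powr (- p)) * Q < \<beta> / 3"
    using \<beta> by (intro order_tendstoD(2)) auto
  ultimately have "\<forall>\<^sub>F t in at_top. C * (1 / t) * I (Suc k) < \<beta> / 3 \<and> 16 * (t\<^sup>2 * exp (- t / 2) * t powr (- p)) * Q < \<beta> / 3"
    by (rule eventually_conj)
  then obtain \<delta>0 where \<delta>0: "\<And>t. \<delta>0 \<le> t \<Longrightarrow> C * (1 / t) * I (Suc k) < \<beta> / 3"
      "\<And>t. \<delta>0 \<le> t \<Longrightarrow> 16 * (t\<^sup>2 * exp (- t / 2) * t powr (- p)) * Q < \<beta> / 3"
    unfolding eventually_at_top_linorder by blast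
  define \<delta> where "\<delta> = max 1 \<delta>0"
  have Rle: "(\<integral>\<xi>. (norm (R t \<xi>))\<^sup>2 \<partial>lborel) \<le> t powr p * \<beta>" if t: "\<delta> \<le> t" for t
  proof -
    have t1: "1 \<le> t" and t0: "\<delta>0 \<le> t"
      using t by (auto simp: \<delta>_def)
    have "t powr (p - 1) = t powr p * (1 / t)"
      using t1 by (simp add: powr_diff)
    then have 1: "C * (t powr (p - 1) * I (Suc k)) = t powr p * (C * (1 / t) * I (Suc k))"
      by (simp only: mult_ac)
    have "t powr p * t powr (- p) = 1"
      using t1 by (simp add: powr_add[symmetric])
    then have "16 * (t\<^sup>2 * exp (- t / 2)) * Q = (t powr p * t powr (- p)) * (16 * (t\<^sup>2 * exp (- t / 2)) * Q)"
      by simp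
    then have 2: "16 * (t\<^sup>2 * exp (- t / 2)) * Q = t powr p * (16 * (t\<^sup>2 * exp (- t / 2) * t powr (- p)) * Q)"
      by (simp only: mult_ac)
    have "(\<integral>\<xi>. (norm (R t \<xi>))\<^sup>2 \<partial>lborel) \<le> t powr p * (\<beta> / 3) + t powr p * (C * (1 / t) * I (Suc k))
        + t powr p * (16 * (t\<^sup>2 * exp (- t / 2) * t powr (- p)) * Q)"
      using R(2)[OF t1] unfolding 1 2 .
    also have "\<dots> \<le> t powr p * (\<beta> / 3) + t powr p * (\<beta> / 3) + t powr p * (\<beta> / 3)"
      using \<delta>0[OF t0] by (intro add_mono mult_left_mono) auto
    finally show ?thesis
      by (simp add: mult.commute)
  qed
  define J where "J = (\<integral>\<xi>. indicator {\<xi>. norm \<xi> \<le> 1 / 2} \<xi> * (norm (BE 1 \<xi>))\<^sup>2 \<partial>lborel)"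
  have J: "0 \<le> J" "J \<le> IB"
  proof -
    have hB1: "has_bochner_integral lborel (\<lambda>\<xi>. (norm (BE 1 \<xi>))\<^sup>2) IB"
      using hB[of 1] by simp
    show "0 \<le> J"
      by (simp add: J_def)
    have "J \<le> (\<integral>\<xi>. (norm (BE 1 \<xi>))\<^sup>2 \<partial>lborel)"
      unfolding J_def
    proof (rule integral_mono')
      show "integrable lborel (\<lambda>\<xi>. (norm (BE 1 \<xi>))\<^sup>2)"
        using hB1 by (simp add: has_bochner_integral_iff)
    qed (auto simp: indicator_def)
    then show "J \<le> IB"
      using hB1 by (simp add: has_bochner_integral_iff)
  qed
  have norm_B: "L2_norm_on {\<xi>. norm \<xi> \<le> 1 / 2} (\<lambda>\<xi>. B_profile k v \<xi> * complex_of_real (exp (- (norm \<xi>)\<^sup>2))) = sqrt J"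
  proof -
    have eq: "(\<lambda>\<xi>. B_profile k v \<xi> * complex_of_real (exp (- (norm \<xi>)\<^sup>2))) = BE 1"
      by (simp add: BE_def fun_eq_iff)
    show ?thesis
      unfolding eq L2_norm_on_def J_def set_lebesgue_integral_def
      by (simp add: integral_completion)
  qed
  have sqrt_powr: "t powr (- real CARD('n) / 4 - real k / 2) = sqrt (t powr p)" if "0 < t" for t
  proof -
    have "sqrt (t powr p) = t powr (p / 2)"
      using that by (simp add: powr_half_sqrt[symmetric] powr_powr)
    moreover have "p / 2 = - real CARD('n) / 4 - real k / 2"
      by (simp add: p_def field_simps)
    ultimately show ?thesis
      by simp
  qed
  have key: "D t \<in> L2 \<and> 1 / 2 * sqrt J * sqrt (t powr p) \<le> L2_norm (D t) \<and>
      L2_norm (D t) \<le> sqrt (2 * \<beta> + 2 * IB) * sqrt (t powr p)" if t: "\<delta> \<le> t" for t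
  proof -
    have t1: "1 \<le> t"
      using t by (simp add: \<delta>_def)
    have intBE: "integrable lborel (\<lambda>\<xi>. (norm (BE t \<xi>))\<^sup>2)"
      and valBE: "(\<integral>\<xi>. (norm (BE t \<xi>))\<^sup>2 \<partial>lborel) = t powr p * IB"
      using hB[of t] t1 by (auto simp: has_bochner_integral_iff)
    have D_le: "(norm (D t \<xi>))\<^sup>2 \<le> 2 * (norm (R t \<xi>))\<^sup>2 + 2 * (norm (BE t \<xi>))\<^sup>2" for \<xi>
      using norm_square_add_le[of "R t \<xi>" "BE t \<xi>"] by (simp add: R_def)
    \<comment> \<open>Read backwards, with the leading part as difference of \<open>D\<close> and
      \<open>R\<close>, the same inequality gives the lower bound.\<close>
    have BE_le: "(norm (BE t \<xi>))\<^sup>2 \<le> 2 * (norm (D t \<xi>))\<^sup>2 + 2 * (norm (R t \<xi>))\<^sup>2" for \<xi>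
      using norm_square_add_le[of "D t \<xi>" "- R t \<xi>"] by (simp add: R_def norm_minus_commute)
    have intD: "integrable lborel (\<lambda>\<xi>. (norm (D t \<xi>))\<^sup>2)"
    proof (rule Bochner_Integration.integrable_bound)
      show "integrable lborel (\<lambda>\<xi>. 2 * (norm (R t \<xi>))\<^sup>2 + 2 * (norm (BE t \<xi>))\<^sup>2)"
        using R(1)[OF t1] intBE by simp
      show "AE \<xi> in lborel. norm ((norm (D t \<xi>))\<^sup>2) \<le> norm (2 * (norm (R t \<xi>))\<^sup>2 + 2 * (norm (BE t \<xi>))\<^sup>2)"
        using D_le by (intro AE_I2) simp
    qed measurable
    define N where "N = (\<integral>\<xi>. (norm (D t \<xi>))\<^sup>2 \<partial>lborel)"
    have "N \<le> (\<integral>\<xi>. 2 * (norm (R t \<xi>))\<^sup>2 + 2 * (norm (BE t \<xi>))\<^sup>2 \<partial>lborel)"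
      unfolding N_def using R(1)[OF t1] intBE by (intro integral_mono intD D_le) simp
    also have "\<dots> \<le> 2 * (t powr p * \<beta>) + 2 * (t powr p * IB)"
      using R(1)[OF t1] intBE Rle[OF t] by (simp add: valBE)
    finally have upper: "N \<le> (2 * \<beta> + 2 * IB) * t powr p"
      by (simp add: algebra_simps)
    have "t powr p * IB \<le> (\<integral>\<xi>. 2 * (norm (D t \<xi>))\<^sup>2 + 2 * (norm (R t \<xi>))\<^sup>2 \<partial>lborel)"
      unfolding valBE[symmetric] using R(1)[OF t1] intD by (intro integral_mono intBE BE_le) simp
    also have "\<dots> \<le> 2 * N + 2 * (t powr p * \<beta>)"
      using R(1)[OF t1] intD Rle[OF t] by (simp add: N_def)
    finally have lower: "t powr p * IB \<le> 2 * N + 2 * (t powr p * \<beta>)" .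
    \<comment> \<open>\<open>J\<close> belongs to the ball and is at most \<open>IB\<close>, so the
      estimate over the whole space suffices; for \<open>IB\<close> zero, \<open>J\<close> is zero
      as well.\<close>
    have "1 / 4 * J * t powr p \<le> N"
    proof (cases "IB = 0")
      case True
      then show ?thesis
        using J by (simp add: N_def)
    next
      case False
      then have "IB / 4 * t powr p \<le> N"
        using lower by (simp add: \<beta>_def field_simps)
      moreover have "1 / 4 * J * t powr p \<le> IB / 4 * t powr p"
        using J by (intro mult_right_mono) auto
      ultimately show ?thesis
        by linarith
    qed
    then have "sqrt (1 / 4 * J * t powr p) \<le> sqrt N"
      by (rule real_sqrt_le_mono)
    then have "1 / 2 * sqrt J * sqrt (t powr p) \<le> sqrt N"
      by (simp add: real_sqrt_mult real_sqrt_divide)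
    moreover have "sqrt N \<le> sqrt (2 * \<beta> + 2 * IB) * sqrt (t powr p)"
      using real_sqrt_le_mono[OF upper] by (simp only: real_sqrt_mult)
    moreover have "D t \<in> L2" "L2_norm (D t) = sqrt N"
      unfolding N_def using intD by (intro L2_borel; measurable)+
    ultimately show ?thesis
      by simp
  qed
  have "0 < sqrt (2 * \<beta> + 2 * IB)"
    using \<beta> IB0 by simp
  moreover have "1 \<le> \<delta>"
    by (simp add: \<delta>_def)
  ultimately show ?thesis
    using key sqrt_powr unfolding norm_B D_def[abs_def] by (intro exI[of _ "sqrt (2 * \<beta> + 2 * IB)"] exI[of _ \<delta>]) auto
qed

end
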